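(* Let $A=\frac{1}{2i}(x\cdot\nabla+\nabla\cdot x)=-ix\cdot\nabla-i\frac n2$ with domain $D(A)=\{\varphi\in H^1(\mathbb{R}^n):x\cdot\nabla\varphi\in L^2(\mathbb{R}^n)\}$, and let $B=-\Delta$ with domain $D(B)=H^2(\mathbb{R}^n)$, both as operators in $L^2(\mathbb{R}^n)$. Let $\varphi\in M=D(A)\cap D(B)$ satisfy $A\varphi\neq0$ and $B\varphi\neq0$. Then $$\begin{aligned}2\|\nabla\varphi\|^2&=2(B\varphi|\varphi)\\&=-i([A,B]\varphi|\varphi)\\&=-2\operatorname{Im}(A\varphi|B\varphi)\\&=\|A\varphi\|\|B\varphi\|\left(2-\left\|\frac{A\varphi}{\|A\varphi\|}+i\frac{B\varphi}{\|B\varphi\|}\right\|^2\right).\end{aligned}$$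
   Context: $L^2(\mathbb{R}^n)$ is the space of complex-valued square integrable functions with scalar product $(\varphi|\psi)=\int_{\mathbb{R}^n}\varphi\overline{\psi}\,dx$ (linear in the first variable, antilinear in the second) and norm $\|\cdot\|$; $\|\nabla\varphi\|^2=\sum_{j=1}^n\|\partial_j\varphi\|^2$. $H^1(\mathbb{R}^n)$ and $H^2(\mathbb{R}^n)$ are the Sobolev spaces of $L^2$ functions with distributional derivatives up to order 1, respectively 2, in $L^2(\mathbb{R}^n)$. The commutator is understood as a sesquilinear form on $M=D(A)\cap D(B)$: $([A,B]\varphi|\psi)=(B\varphi|A\psi)-(A\varphi|B\psi)$ for $\varphi,\psi\in M$. *)

theory Defs
  imports "HOL-Analysis.Analysis"
begin

text \<open>
  Elements of the space are represented by Borel functions; every Lebesgue class has such a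
  representative, and functions are identified if they agree almost everywhere. The notions below
  depend only on the almost-everywhere class.
  The dimension n is \<^term>\<open>CARD('n)\<close>.
\<close>

definition L2 :: "(real^'n \<Rightarrow> complex) set" where
  "L2 = {f. f \<in> borel_measurable lborel \<and> integrable lborel (\<lambda>x. (cmod (f x))\<^sup>2)}"

definition l2_inner :: "(real^'n \<Rightarrow> complex) \<Rightarrow> (real^'n \<Rightarrow> complex) \<Rightarrow> complex" where
  "l2_inner f g = (LINT x|lborel. f x * cnj (g x))"

definition l2_norm :: "(real^'n \<Rightarrow> complex) \<Rightarrow> real" where
  "l2_norm f = sqrt (LINT x|lborel. (cmod (f x))\<^sup>2)"

definition l2_zero :: "(real^'n \<Rightarrow> complex) \<Rightarrow> bool" where
  "l2_zero f \<longleftrightarrow> (AE x in lborel. f x = 0)"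

definition partial :: "'n \<Rightarrow> (real^'n \<Rightarrow> complex) \<Rightarrow> real^'n \<Rightarrow> complex" where
  "partial j f x = frechet_derivative f (at x) (axis j 1)"

primrec C_diff :: "nat \<Rightarrow> (real^'n \<Rightarrow> complex) \<Rightarrow> bool" where
  "C_diff 0 f \<longleftrightarrow> continuous_on UNIV f"
| "C_diff (Suc k) f \<longleftrightarrow> (\<forall>x. f differentiable (at x)) \<and> (\<forall>j. C_diff k (partial j f))"

definition test_functions :: "(real^'n \<Rightarrow> complex) set" where
  "test_functions = {\<psi>. (\<forall>k. C_diff k \<psi>) \<and> compact (closure {x. \<psi> x \<noteq> 0})}"

text \<open>
  This is only used for square integrable \<open>f\<close> and \<open>g\<close>, for which both integrals exist. The pairing
  is the bilinear one of distribution theory, without conjugation.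
\<close>

definition is_weak_partial :: "'n \<Rightarrow> (real^'n \<Rightarrow> complex) \<Rightarrow> (real^'n \<Rightarrow> complex) \<Rightarrow> bool" where
  "is_weak_partial j f g \<longleftrightarrow>
     (\<forall>\<psi>\<in>test_functions.
        (LINT x|lborel. f x * partial j \<psi> x) = - (LINT x|lborel. g x * \<psi> x))"

text \<open>
  A weak derivative is unique only up to null sets, so the choice operator merely picks a
  representative. It is meaningful whenever a square integrable weak derivative exists.
\<close>

definition weak_partial :: "'n \<Rightarrow> (real^'n \<Rightarrow> complex) \<Rightarrow> real^'n \<Rightarrow> complex" where
  "weak_partial j f = (SOME g. g \<in> L2 \<and> is_weak_partial j f g)"

definition H1 :: "(real^'n \<Rightarrow> complex) set" where
  "H1 = {f \<in> L2. \<forall>j. \<exists>g\<in>L2. is_weak_partial j f g}"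

definition H2 :: "(real^'n \<Rightarrow> complex) set" where
  "H2 = {f \<in> H1. \<forall>j. weak_partial j f \<in> H1}"

definition grad_norm :: "(real^'n \<Rightarrow> complex) \<Rightarrow> real" where
  "grad_norm f = sqrt (\<Sum>j\<in>UNIV. (l2_norm (weak_partial j f))\<^sup>2)"

definition x_grad :: "(real^'n \<Rightarrow> complex) \<Rightarrow> real^'n \<Rightarrow> complex" where
  "x_grad f x = (\<Sum>j\<in>UNIV. complex_of_real (x $ j) * weak_partial j f x)"

text \<open>
  Since the distribution \<open>\<nabla> \<cdot> (x f)\<close> equals \<open>x \<cdot> \<nabla> f + n f\<close>, the following expression is
  \<open>(x \<cdot> \<nabla> + \<nabla> \<cdot> x) f / (2 \<i>)\<close>.
\<close>

definition op_A :: "(real^'n \<Rightarrow> complex) \<Rightarrow> real^'n \<Rightarrow> complex" where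
  "op_A f x = - \<i> * x_grad f x - \<i> * (of_nat CARD('n) / 2) * f x"

definition dom_A :: "(real^'n \<Rightarrow> complex) set" where
  "dom_A = {f \<in> H1. x_grad f \<in> L2}"

definition op_B :: "(real^'n \<Rightarrow> complex) \<Rightarrow> real^'n \<Rightarrow> complex" where
  "op_B f x = - (\<Sum>j\<in>UNIV. weak_partial j (weak_partial j f) x)"

definition dom_B :: "(real^'n \<Rightarrow> complex) set" where
  "dom_B = H2"

text \<open>The value \<open>([S,T] f | g)\<close> of the commutator form, for \<open>f\<close> and \<open>g\<close> in both domains.\<close>

definition commutator_form ::
  "((real^'n \<Rightarrow> complex) \<Rightarrow> real^'n \<Rightarrow> complex) \<Rightarrow> ((real^'n \<Rightarrow> complex) \<Rightarrow> real^'n \<Rightarrow> complex)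
     \<Rightarrow> (real^'n \<Rightarrow> complex) \<Rightarrow> (real^'n \<Rightarrow> complex) \<Rightarrow> complex" where
  "commutator_form S T f g = l2_inner (T f) (S g) - l2_inner (S f) (T g)"

end

theory Submission
  imports Defs
begin

text \<open>
  The only analytic content is that \<open>Re (x \<cdot> \<nabla>\<phi> | \<Delta>\<phi>) = (n / 2 - 1) \<parallel>\<nabla>\<phi>\<parallel>\<^sup>2\<close> and
  \<open>(-\<Delta>\<phi> | \<phi>) = \<parallel>\<nabla>\<phi>\<parallel>\<^sup>2\<close> for \<open>\<phi>\<close> in the domain; the rest is algebra in a Hilbert space. Both follow
  from \<open>\<integral> (\<partial>\<^sub>j u) v + u (\<partial>\<^sub>j v) = 0\<close> for square integrable \<open>u\<close>, \<open>v\<close> with square integrable weak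
  derivatives. No mollification is needed for the latter: testing shows that
  \<open>u (x + t e\<^sub>j) - u x\<close> is the integral of \<open>\<partial>\<^sub>j u\<close> over the segment for almost every \<open>x\<close>, and the
  product rule comes from comparing the translation invariant integral of \<open>u v\<close> at \<open>0\<close> and \<open>t\<close>.
\<close>

section \<open>Smooth compactly supported functions\<close>

text \<open>Membership in both domains makes the first and second weak derivatives of \<phi> and the
  sum x . grad \<phi> square integrable, but says nothing about a single product of
  \<open>x $ k\<close> with \<open>weak_partial k \<phi>\<close>. Integration by parts works on one
  pair of indices at a time, so it needs bounded weights, and the cutoff can be removed only after
  the terms have been summed back to x . grad \<phi>. In the constant n / 2 - 1 the first term is
  half the divergence of the field x, the second comes from its Jacobian, the identity. The multiple
  of \<phi> in \<open>op_A\<close> removes exactly n / 2, so the result does not depend on the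
  dimension.

  Statements about weak derivatives are decided by test functions, and two properties of these carry
  the weight: there are enough of them to detect a nonzero function, and their mixed partial
  derivatives commute. Products of one-variable functions supply both: they approximate the
  indicator of a box, and each partial derivative touches a single factor.\<close>

definition flat :: "real poly \<Rightarrow> real \<Rightarrow> real" where
  "flat P s = (if s > 0 then poly P (inverse s) * exp (- inverse s) else 0)"

lemma poly_times_exp_minus_tendsto_0:
  fixes P :: "real poly"
  shows "((\<lambda>u. poly P u * exp (- u)) \<longlongrightarrow> 0) at_top"
proof -
  have "((\<lambda>u. \<Sum>i\<le>degree P. coeff P i * (u ^ i / exp u)) \<longlongrightarrow> (\<Sum>i\<le>degree P. coeff P i * 0)) at_top"
    by (intro tendsto_intros tendsto_power_div_exp_0)
  moreover have "(\<lambda>u. \<Sum>i\<le>degree P. coeff P i * (u ^ i / exp u)) = (\<lambda>u. poly P u * exp (- u))"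
    by (simp add: poly_altdef sum_distrib_right exp_minus divide_inverse mult.assoc)
  ultimately show ?thesis by simp
qed

text \<open>This is why \<open>flat\<close> carries a polynomial: in u = 1 / s, differentiation
  sends P(u) exp(-u) to u^2 (P - P')(u) exp(-u), so the family is closed under derivatives;
  \<open>[:0, 0, 1:]\<close> is u^2.\<close>

lemma flat_has_derivative:
  "(flat P has_real_derivative flat ([:0, 0, 1:] * (P - pderiv P)) s) (at s)"
proof -
  consider "s > 0" | "s < 0" | "s = 0" by linarith
  then show ?thesis
  proof cases
    case 1
    have "((\<lambda>s. poly P (inverse s) * exp (- inverse s)) has_real_derivative
        flat ([:0, 0, 1:] * (P - pderiv P)) s) (at s)"
      using 1 by (auto intro!: derivative_eq_intros simp: flat_def field_simps power2_eq_square)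
    then show ?thesis
      by (rule has_field_derivative_transform_within_open[where S="{0<..}"])
        (use 1 in \<open>auto simp: flat_def\<close>)
  next
    case 2
    have "((\<lambda>s. 0) has_real_derivative flat ([:0, 0, 1:] * (P - pderiv P)) s) (at s)"
      using 2 by (auto simp: flat_def)
    then show ?thesis
      by (rule has_field_derivative_transform_within_open[where S="{..<0}"])
        (use 2 in \<open>auto simp: flat_def\<close>)
  next
    case 3
    have "((\<lambda>h. flat P h / h) \<longlongrightarrow> 0) (at_right 0)"
    proof (rule Lim_transform_eventually)
      \<comment> \<open>Dividing by h multiplies the polynomial by its variable, so the difference
        quotient is again a polynomial times exp(-u), with u = 1 / h tending to infinity.\<close>
      have "((\<lambda>h. poly ([:0, 1:] * P) (inverse h) * exp (- inverse h)) \<longlongrightarrow> 0) (at_right 0)"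
        by (rule filterlim_compose[OF poly_times_exp_minus_tendsto_0 filterlim_inverse_at_top_right])
      then show "((\<lambda>h. inverse h * poly P (inverse h) * exp (- inverse h)) \<longlongrightarrow> 0) (at_right 0)"
        by simp
      show "\<forall>\<^sub>F h in at_right 0. inverse h * poly P (inverse h) * exp (- inverse h) = flat P h / h"
        by (auto simp: flat_def eventually_at_filter field_simps)
    qed
    moreover have "((\<lambda>h. flat P h / h) \<longlongrightarrow> 0) (at_left 0)"
      by (rule Lim_transform_eventually[OF tendsto_const]) (auto simp: flat_def eventually_at_filter)
    ultimately have "((\<lambda>h. flat P h / h) \<longlongrightarrow> 0) (at 0)"
      by (simp add: filterlim_at_split)
    then show ?thesis
      using 3 by (simp add: has_field_derivative_iff flat_def)
  qed
qed

text \<open>Generated syntactically so that closure under differentiation is a rule induction, and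
  with it smoothness of every order. The affine argument of \<open>flat\<close> admits rescaled and
  reflected copies, whose products are bumps.\<close>

inductive smooth1 :: "(real \<Rightarrow> real) \<Rightarrow> bool" where
  const: "smooth1 (\<lambda>s. c)"
| ident: "smooth1 (\<lambda>s. s)"
| flat: "smooth1 (\<lambda>s. flat P (a * s + b))"
| add: "smooth1 p \<Longrightarrow> smooth1 q \<Longrightarrow> smooth1 (\<lambda>s. p s + q s)"
| mult: "smooth1 p \<Longrightarrow> smooth1 q \<Longrightarrow> smooth1 (\<lambda>s. p s * q s)"

lemma smooth1_derivative:
  "smooth1 p \<Longrightarrow> \<exists>q. smooth1 q \<and> (\<forall>s. (p has_real_derivative q s) (at s))"
proof (induction rule: smooth1.induct)
  case (const c)
  then show ?case by (auto intro!: exI[of _ "\<lambda>s. 0"] smooth1.intros)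
next
  case ident
  then show ?case by (auto intro!: exI[of _ "\<lambda>s. 1"] smooth1.intros)
next
  case (flat P a b)
  have "((\<lambda>s. flat P (a * s + b)) has_real_derivative
      flat ([:0, 0, 1:] * (P - pderiv P)) (a * s + b) * a) (at s)" for s
    by (rule DERIV_chain2[OF flat_has_derivative]) (auto intro!: derivative_eq_intros)
  then show ?case
    by (intro exI[of _ "\<lambda>s. flat ([:0, 0, 1:] * (P - pderiv P)) (a * s + b) * a"] conjI allI
        smooth1.mult smooth1.flat smooth1.const)
next
  case (add p q)
  then show ?case by (blast intro: smooth1.intros derivative_intros)
next
  case (mult p q)
  then obtain p' q' where *: "smooth1 p'" "smooth1 q'"
    "\<And>s. (p has_real_derivative p' s) (at s)" "\<And>s. (q has_real_derivative q' s) (at s)" by blast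
  then have "((\<lambda>s. p s * q s) has_real_derivative p' s * q s + q' s * p s) (at s)" for s
    by (intro derivative_intros)
  then show ?case
    using * mult.hyps by (intro exI[of _ "\<lambda>s. p' s * q s + q' s * p s"]) (auto intro: smooth1.intros)
qed

text \<open>A partial derivative of such a product replaces one factor and yields a product again,
  so smoothness in several variables reduces to one variable.\<close>

definition tensor :: "('n \<Rightarrow> real \<Rightarrow> real) \<Rightarrow> real^'n \<Rightarrow> complex" where
  "tensor p x = complex_of_real (\<Prod>i\<in>UNIV. p i (x $ i))"

lemma partial_eqI:
  "(f has_derivative f') (at x) \<Longrightarrow> partial j f x = f' (axis j 1)"
  unfolding partial_def by (metis frechet_derivative_at)

lemma tensor_has_derivative:
  assumes "\<And>i s. (p i has_real_derivative q i s) (at s)"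
  shows "(tensor p has_derivative
    (\<lambda>y. complex_of_real (\<Sum>i\<in>UNIV. y $ i * q i (x $ i) * (\<Prod>k\<in>UNIV - {i}. p k (x $ k))))) (at x)"
proof -
  have *: "((\<lambda>x. p i (x $ i)) has_derivative (\<lambda>y. y $ i * q i (x $ i))) (at x)" for i
  proof -
    have "((\<lambda>x. x $ i) has_derivative (\<lambda>y. y $ i)) (at x)"
      by (rule bounded_linear_imp_has_derivative) (rule bounded_linear_vec_nth)
    then have "((\<lambda>x. p i (x $ i)) has_derivative (\<lambda>y. q i (x $ i) * y $ i)) (at x)"
      by (rule has_derivative_compose) (use assms[of i "x $ i"] in \<open>simp add: has_field_derivative_def\<close>)
    then show ?thesis by (simp add: mult.commute)
  qed
  have "((\<lambda>x. \<Prod>i\<in>UNIV. p i (x $ i)) has_derivative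
    (\<lambda>y. \<Sum>i\<in>UNIV. y $ i * q i (x $ i) * (\<Prod>k\<in>UNIV - {i}. p k (x $ k)))) (at x)"
    by (rule has_derivative_prod) (rule *)
  then show ?thesis
    unfolding tensor_def by (rule has_derivative_of_real)
qed

lemma partial_tensor:
  assumes "\<And>i. smooth1 (p i)" "smooth1 q" "\<And>s. (p j has_real_derivative q s) (at s)"
  shows "partial j (tensor p) = tensor (p(j := q))"
proof
  fix x :: "real^'a"
  obtain r where r: "\<And>i s. (p i has_real_derivative r i s) (at s)"
    using smooth1_derivative[OF assms(1)] by metis
  have rj: "r j s = q s" for s
    using r[of j s] assms(3)[of s] by (rule DERIV_unique)
  have "partial j (tensor p) x = complex_of_real (\<Sum>i\<in>UNIV. axis j 1 $ i * r i (x $ i) * (\<Prod>k\<in>UNIV - {i}. p k (x $ k)))"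
    by (rule partial_eqI[OF tensor_has_derivative[OF r]])
  also have "(\<Sum>i\<in>UNIV. axis j 1 $ i * r i (x $ i) * (\<Prod>k\<in>UNIV - {i}. p k (x $ k)))
      = (\<Sum>i\<in>UNIV. if i = j then q (x $ j) * (\<Prod>k\<in>UNIV - {j}. p k (x $ k)) else 0)"
    by (rule sum.cong) (auto simp: axis_def rj)
  also have "\<dots> = (\<Prod>i\<in>UNIV. (p(j := q)) i (x $ i))"
    by (simp add: prod.remove[of UNIV j])
  finally show "partial j (tensor p) x = tensor (p(j := q)) x"
    unfolding tensor_def[of "p(j := q)"] .
qed

lemma tensor_differentiable:
  assumes "\<And>i. smooth1 (p i)"
  shows "tensor p differentiable (at x)"
proof -
  obtain r where r: "\<And>i s. (p i has_real_derivative r i s) (at s)"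
    using smooth1_derivative[OF assms] by metis
  show ?thesis unfolding differentiable_def by (rule exI, rule tensor_has_derivative[OF r])
qed

lemma C_diff_tensor: "(\<And>i. smooth1 (p i)) \<Longrightarrow> C_diff k (tensor p)"
proof (induction k arbitrary: p)
  case 0
  then show ?case
    by (auto intro!: differentiable_imp_continuous_on
        simp: differentiable_on_def tensor_differentiable differentiable_at_withinI)
next
  case (Suc k)
  have "C_diff k (partial j (tensor p))" for j
  proof -
    obtain q where q: "smooth1 q" "\<And>s. (p j has_real_derivative q s) (at s)"
      using smooth1_derivative[OF Suc.prems] by metis
    then have "C_diff k (tensor (p(j := q)))"
      using Suc.prems by (intro Suc.IH) auto
    moreover have "partial j (tensor p) = tensor (p(j := q))"
      by (rule partial_tensor) (use Suc.prems q in auto)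
    ultimately show ?thesis by simp
  qed
  then show ?case by (simp add: tensor_differentiable Suc.prems)
qed

text \<open>Two derivatives in different directions replace factors at different indices, and such
  updates commute. Symmetry for products suffices, because equality of weak derivatives is tested on
  tensors alone.\<close>

lemma partial_tensor_commute:
  assumes "\<And>i. smooth1 (p i)"
  shows "partial j (partial k (tensor p)) = partial k (partial j (tensor p))"
proof (cases "j = k")
  case False
  obtain a b where ab: "smooth1 a" "\<And>s. (p j has_real_derivative a s) (at s)"
    "smooth1 b" "\<And>s. (p k has_real_derivative b s) (at s)"
    using smooth1_derivative[OF assms] by metis
  have "partial j (partial k (tensor p)) = tensor ((p(k := b))(j := a))"
  proof -
    have "partial k (tensor p) = tensor (p(k := b))"
      by (rule partial_tensor) (use ab assms in auto)
    moreover have "partial j (tensor (p(k := b))) = tensor ((p(k := b))(j := a))"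
      by (rule partial_tensor) (use ab assms False in auto)
    ultimately show ?thesis by simp
  qed
  moreover have "partial k (partial j (tensor p)) = tensor ((p(j := a))(k := b))"
  proof -
    have "partial j (tensor p) = tensor (p(j := a))"
      by (rule partial_tensor) (use ab assms in auto)
    moreover have "partial k (tensor (p(j := a))) = tensor ((p(j := a))(k := b))"
      by (rule partial_tensor) (use ab assms False in auto)
    ultimately show ?thesis by simp
  qed
  ultimately show ?thesis using False by (simp add: fun_upd_twist)
qed simp

section \<open>Calculus of the classes \<open>C_diff k\<close>\<close>

lemma C_diff_Suc_D: "C_diff (Suc k) f \<Longrightarrow> C_diff k f"
proof (induction k arbitrary: f)
  case 0
  then show ?case
    by (auto intro!: differentiable_imp_continuous_on simp: differentiable_on_def differentiable_at_withinI)
next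
  case (Suc k)
  then show ?case by (metis C_diff.simps(2))
qed

lemma C_diff_const: "C_diff k (\<lambda>x. c)"
proof (induction k arbitrary: c)
  case (Suc k)
  have "partial j (\<lambda>x. c) = (\<lambda>x. 0)" for j :: 'a
    by (rule ext, subst partial_eqI[OF has_derivative_const]) simp
  then show ?case using Suc by simp
qed simp

lemma has_derivative_frechet:
  "f differentiable (at x) \<Longrightarrow> (f has_derivative frechet_derivative f (at x)) (at x)"
  by (simp add: frechet_derivative_works)

lemma partial_add:
  "f differentiable (at x) \<Longrightarrow> g differentiable (at x) \<Longrightarrow>
    partial j (\<lambda>x. f x + g x) x = partial j f x + partial j g x"
  by (subst partial_eqI[OF has_derivative_add[OF has_derivative_frechet has_derivative_frechet]])
    (auto simp: partial_def)

lemma partial_mult: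
  "f differentiable (at x) \<Longrightarrow> g differentiable (at x) \<Longrightarrow>
    partial j (\<lambda>x. f x * g x) x = f x * partial j g x + partial j f x * g x"
  by (subst partial_eqI[OF has_derivative_mult[OF has_derivative_frechet has_derivative_frechet]])
    (auto simp: partial_def)

lemma partial_cnj:
  assumes "f differentiable (at x)"
  shows "partial j (\<lambda>x. cnj (f x)) x = cnj (partial j f x)"
  by (subst partial_eqI[OF has_derivative_cnj[OF has_derivative_frechet[OF assms]]])
    (auto simp: partial_def)

lemma affine_has_derivative:
  "f differentiable (at (c *\<^sub>R x + d)) \<Longrightarrow>
    ((\<lambda>x. f (c *\<^sub>R x + d)) has_derivative (\<lambda>y. frechet_derivative f (at (c *\<^sub>R x + d)) (c *\<^sub>R y))) (at x)"
  by (rule has_derivative_compose[where f="\<lambda>x. c *\<^sub>R x + d"])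
    (auto intro!: derivative_eq_intros dest: has_derivative_frechet)

lemma partial_affine:
  assumes "f differentiable (at (c *\<^sub>R x + d))"
  shows "partial j (\<lambda>x. f (c *\<^sub>R x + d)) x = of_real c * partial j f (c *\<^sub>R x + d)"
proof -
  interpret bounded_linear "frechet_derivative f (at (c *\<^sub>R x + d))"
    using has_derivative_frechet[OF assms] by (rule has_derivative_bounded_linear)
  show ?thesis
    by (subst partial_eqI[OF affine_has_derivative[OF assms]])
      (simp only: partial_def scaleR, simp only: scaleR_conv_of_real)
qed

lemma C_diff_add: "C_diff k f \<Longrightarrow> C_diff k g \<Longrightarrow> C_diff k (\<lambda>x. f x + g x)"
proof (induction k arbitrary: f g)
  case (Suc k)
  have "partial j (\<lambda>x. f x + g x) = (\<lambda>x. partial j f x + partial j g x)" for j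
    using Suc.prems by (intro ext partial_add) auto
  then show ?case using Suc by auto
qed (auto intro: continuous_intros)

lemma C_diff_mult: "C_diff k f \<Longrightarrow> C_diff k g \<Longrightarrow> C_diff k (\<lambda>x. f x * g x)"
proof (induction k arbitrary: f g)
  case (Suc k)
  have "partial j (\<lambda>x. f x * g x) = (\<lambda>x. f x * partial j g x + partial j f x * g x)" for j
    using Suc.prems by (intro ext partial_mult) auto
  \<comment> \<open>The product rule leaves one factor undifferentiated, so its order has to be
    lowered from \<open>Suc k\<close> to \<open>k\<close>.\<close>
  then show ?case using Suc.prems Suc.IH C_diff_Suc_D[OF Suc.prems(1)] C_diff_Suc_D[OF Suc.prems(2)]
    by (auto intro!: C_diff_add)
qed (auto intro: continuous_intros)

lemma C_diff_cnj: "C_diff k f \<Longrightarrow> C_diff k (\<lambda>x. cnj (f x))"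
proof (induction k arbitrary: f)
  case (Suc k)
  have "partial j (\<lambda>x. cnj (f x)) = (\<lambda>x. cnj (partial j f x))" for j
    using Suc.prems by (intro ext partial_cnj) auto
  moreover have "(\<lambda>x. cnj (f x)) differentiable (at x)" for x
    using has_derivative_cnj[OF has_derivative_frechet] Suc.prems
    unfolding differentiable_def[of "\<lambda>x. cnj (f x)"] by auto
  ultimately show ?case using Suc by simp
qed (auto intro: continuous_intros)

lemma C_diff_affine: "C_diff k f \<Longrightarrow> C_diff k (\<lambda>x. f (c *\<^sub>R x + d))"
proof (induction k arbitrary: f)
  case 0
  then show ?case
    by (auto intro!: continuous_intros intro: continuous_on_compose2[of UNIV f])
next
  case (Suc k)
  have "partial j (\<lambda>x. f (c *\<^sub>R x + d)) = (\<lambda>x. of_real c * partial j f (c *\<^sub>R x + d))" for j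
    using Suc.prems by (intro ext partial_affine) auto
  moreover have "(\<lambda>x. f (c *\<^sub>R x + d)) differentiable (at x)" for x
    using affine_has_derivative[of f c x d] Suc.prems
    unfolding differentiable_def[of "\<lambda>x. f (c *\<^sub>R x + d)"] by auto
  ultimately show ?case using Suc by (auto intro!: C_diff_mult C_diff_const)
qed

section \<open>Closure properties of test functions\<close>

lemma test_functions_iff:
  "\<psi> \<in> test_functions \<longleftrightarrow> (\<forall>k. C_diff k \<psi>) \<and> bounded {x. \<psi> x \<noteq> 0}"
  by (auto simp: test_functions_def compact_eq_bounded_closed intro: bounded_subset[OF _ closure_subset])

lemma test_differentiable: "\<psi> \<in> test_functions \<Longrightarrow> \<psi> differentiable (at x)"
  unfolding test_functions_iff by (metis C_diff.simps(2))

lemma test_continuous: "\<psi> \<in> test_functions \<Longrightarrow> continuous_on UNIV \<psi>"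
  unfolding test_functions_iff by (metis C_diff.simps(1))

lemma partial_eq_0_outside:
  "x \<notin> closure {x. f x \<noteq> 0} \<Longrightarrow> partial j f x = 0"
proof -
  assume x: "x \<notin> closure {x. f x \<noteq> 0}"
  have "(f has_derivative (\<lambda>y. 0)) (at x)"
    by (rule has_derivative_transform_within_open[OF has_derivative_const[of 0], where s="- closure {x. f x \<noteq> 0}"])
      (use x closure_subset[of "{x. f x \<noteq> 0}"] in auto)
  then show ?thesis by (rule partial_eqI)
qed

lemma test_partial: "\<psi> \<in> test_functions \<Longrightarrow> partial j \<psi> \<in> test_functions"
proof -
  assume "\<psi> \<in> test_functions"
  then have *: "\<forall>k. C_diff k \<psi>" "bounded {x. \<psi> x \<noteq> 0}" by (auto simp: test_functions_iff)
  have "bounded {x. partial j \<psi> x \<noteq> 0}"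
    by (rule bounded_subset[OF bounded_closure[OF *(2)]]) (auto intro: ccontr dest: partial_eq_0_outside)
  moreover have "C_diff k (partial j \<psi>)" for k
    using *(1)[rule_format, of "Suc k"] by simp
  ultimately show ?thesis by (auto simp: test_functions_iff)
qed

lemma test_mult:
  "\<eta> \<in> test_functions \<Longrightarrow> \<psi> \<in> test_functions \<Longrightarrow> (\<lambda>x. \<eta> x * \<psi> x) \<in> test_functions"
  by (auto simp: test_functions_iff C_diff_mult intro: bounded_subset)

lemma test_cmult:
  "\<psi> \<in> test_functions \<Longrightarrow> (\<lambda>x. a * \<psi> x) \<in> test_functions"
  by (auto simp: test_functions_iff C_diff_mult C_diff_const elim: bounded_subset)

lemma test_cnj: "\<psi> \<in> test_functions \<Longrightarrow> (\<lambda>x. cnj (\<psi> x)) \<in> test_functions"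
  by (auto simp: test_functions_iff C_diff_cnj)

text \<open>Translations are the case \<open>c = 1\<close>, dilations the case \<open>d = 0\<close>;
  a nonzero \<open>c\<close> keeps the support bounded.\<close>

lemma test_affine:
  assumes "\<psi> \<in> test_functions" "c \<noteq> 0"
  shows "(\<lambda>x. \<psi> (c *\<^sub>R x + d)) \<in> test_functions"
proof -
  obtain B where B: "\<And>x. \<psi> x \<noteq> 0 \<Longrightarrow> norm x \<le> B"
    using assms(1) by (auto simp: test_functions_iff bounded_iff)
  have "norm x \<le> (B + norm d) / \<bar>c\<bar>" if "\<psi> (c *\<^sub>R x + d) \<noteq> 0" for x
  proof -
    have "norm (c *\<^sub>R x) \<le> norm (c *\<^sub>R x + d) + norm d"
      by (metis add_diff_cancel_right' norm_triangle_ineq4)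
    then show ?thesis using B[OF that] assms(2) by (simp add: field_simps)
  qed
  then have "bounded {x. \<psi> (c *\<^sub>R x + d) \<noteq> 0}"
    by (auto simp: bounded_iff)
  then show ?thesis using assms(1) by (simp add: test_functions_iff C_diff_affine)
qed

lemma test_bounded:
  assumes "\<psi> \<in> test_functions"
  obtains C where "\<And>x. cmod (\<psi> x) \<le> C"
proof -
  have "compact (closure {x. \<psi> x \<noteq> 0})" using assms by (simp add: test_functions_def)
  then have "compact (\<psi> ` closure {x. \<psi> x \<noteq> 0})"
    using test_continuous[OF assms] by (meson compact_continuous_image continuous_on_subset subset_UNIV)
  then obtain B where "B > 0" "\<And>y. y \<in> \<psi> ` closure {x. \<psi> x \<noteq> 0} \<Longrightarrow> cmod y \<le> B"
    using compact_imp_bounded bounded_pos by metis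
  then have "cmod (\<psi> x) \<le> B" for x
    using closure_subset[of "{x. \<psi> x \<noteq> 0}"] by (cases "\<psi> x = 0") auto
  then show thesis using that by blast
qed

section \<open>Vanishing of functions orthogonal to test functions\<close>

lemma lborel_integrable_shift:
  fixes f :: "'a::euclidean_space \<Rightarrow> 'b::{banach, second_countable_topology}"
  assumes "integrable lborel f"
  shows "integrable lborel (\<lambda>x. f (x + c))"
proof -
  have "integrable (distr lborel borel ((+) c)) f" using assms by (simp add: lborel_distr_plus)
  then have "integrable lborel (\<lambda>x. f (c + x))" by (rule integrable_distr[rotated]) simp
  then show ?thesis by (simp add: add.commute)
qed

lemma lborel_integral_shift:
  fixes f :: "'a::euclidean_space \<Rightarrow> 'b::{banach, second_countable_topology}"
  assumes "f \<in> borel_measurable borel"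
  shows "(LINT x|lborel. f (x + c)) = (LINT x|lborel. f x)"
proof -
  have "(LINT x|lborel. f x) = (LINT x|distr lborel borel ((+) c). f x)"
    by (simp add: lborel_distr_plus)
  also have "\<dots> = (LINT x|lborel. f (c + x))" using assms by (subst integral_distr) auto
  finally show ?thesis by (simp add: add.commute)
qed

lemma L2_square_integrable: "f \<in> L2 \<Longrightarrow> integrable lborel (\<lambda>x. (cmod (f x))\<^sup>2)"
  by (simp add: L2_def)

lemma L2_shift: "f \<in> L2 \<Longrightarrow> (\<lambda>x. f (x + c)) \<in> L2"
  using lborel_integrable_shift[OF L2_square_integrable, of f c]
  by (auto simp: L2_def intro!: measurable_compose[of "\<lambda>x. x + c" _ borel f])

lemma L2_cnj: "f \<in> L2 \<Longrightarrow> (\<lambda>x. cnj (f x)) \<in> L2"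
  using borel_measurable_continuous_onI[OF continuous_on_cnj[OF continuous_on_id]]
  by (auto simp: L2_def intro: measurable_compose)

lemma mult_le_sum_squares: "cmod (a * b) \<le> (cmod a)\<^sup>2 + (cmod b)\<^sup>2"
proof -
  have "0 \<le> (cmod a - cmod b)\<^sup>2 + (cmod a)\<^sup>2 + (cmod b)\<^sup>2" by simp
  then show ?thesis by (simp add: norm_mult power2_eq_square algebra_simps)
qed

lemma L2_mult_integrable:
  assumes "f \<in> L2" "g \<in> L2"
  shows "integrable lborel (\<lambda>x. f x * g x)"
proof (rule Bochner_Integration.integrable_bound)
  show "integrable lborel (\<lambda>x. (cmod (f x))\<^sup>2 + (cmod (g x))\<^sup>2)"
    using assms by (intro Bochner_Integration.integrable_add L2_square_integrable)
qed (use assms in \<open>auto simp: L2_def mult_le_sum_squares\<close>)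

text \<open>Takes the place of the Cauchy-Schwarz inequality: it only serves to bound increments by
  a constant times t, where the size of the constant is immaterial.\<close>

lemma L2_mult_integral_le:
  assumes "f \<in> L2" "g \<in> L2"
  shows "cmod (LINT x|lborel. f x * g x)
    \<le> (LINT x|lborel. (cmod (f x))\<^sup>2) + (LINT x|lborel. (cmod (g x))\<^sup>2)"
proof -
  have "cmod (LINT x|lborel. f x * g x) \<le> (LINT x|lborel. cmod (f x * g x))"
    by (rule integral_norm_bound)
  also have "\<dots> \<le> (LINT x|lborel. (cmod (f x))\<^sup>2 + (cmod (g x))\<^sup>2)"
    using assms by (intro integral_mono) (auto intro: L2_mult_integrable L2_square_integrable mult_le_sum_squares)
  also have "\<dots> = (LINT x|lborel. (cmod (f x))\<^sup>2) + (LINT x|lborel. (cmod (g x))\<^sup>2)"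
    using assms by (simp add: L2_square_integrable)
  finally show ?thesis .
qed

lemma L2_add:
  assumes "f \<in> L2" "g \<in> L2"
  shows "(\<lambda>x. f x + g x) \<in> L2"
proof -
  have [measurable]: "f \<in> borel_measurable borel" "g \<in> borel_measurable borel"
    using assms by (auto simp: L2_def)
  have le: "(cmod (f x + g x))\<^sup>2 \<le> 2 * (cmod (f x))\<^sup>2 + 2 * (cmod (g x))\<^sup>2" for x
  proof -
    have "(cmod (f x + g x))\<^sup>2 \<le> (cmod (f x) + cmod (g x))\<^sup>2"
      by (intro power_mono norm_triangle_ineq) auto
    moreover have "0 \<le> (cmod (f x) - cmod (g x))\<^sup>2" by simp
    ultimately show ?thesis by (simp add: power2_eq_square algebra_simps)
  qed
  have "integrable lborel (\<lambda>x. (cmod (f x + g x))\<^sup>2)"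
    by (rule Bochner_Integration.integrable_bound
        [where f="\<lambda>x. 2 * (cmod (f x))\<^sup>2 + 2 * (cmod (g x))\<^sup>2"])
      (use assms le in \<open>auto simp: L2_square_integrable\<close>)
  then show ?thesis using assms by (simp add: L2_def)
qed

lemma L2_mult_bounded:
  assumes "f \<in> L2" "h \<in> borel_measurable borel" "\<And>x. cmod (h x) \<le> C"
  shows "(\<lambda>x. h x * f x) \<in> L2"
proof -
  have [measurable]: "f \<in> borel_measurable borel" "h \<in> borel_measurable borel"
    using assms by (auto simp: L2_def)
  have le: "(cmod (h x * f x))\<^sup>2 \<le> C\<^sup>2 * (cmod (f x))\<^sup>2" for x
    using assms(3)[of x] by (auto simp: norm_mult power_mult_distrib intro!: mult_right_mono power_mono)
  have "integrable lborel (\<lambda>x. (cmod (h x * f x))\<^sup>2)"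
  proof (rule Bochner_Integration.integrable_bound)
    show "integrable lborel (\<lambda>x. C\<^sup>2 * (cmod (f x))\<^sup>2)"
      using assms(1) by (intro integrable_mult_right L2_square_integrable)
    show "AE x in lborel. norm ((cmod (h x * f x))\<^sup>2) \<le> norm (C\<^sup>2 * (cmod (f x))\<^sup>2)"
      using le by (intro AE_I2) simp
  qed simp
  then show ?thesis by (simp add: L2_def)
qed

lemma L2_cmult: "f \<in> L2 \<Longrightarrow> (\<lambda>x. c * f x) \<in> L2"
  by (rule L2_mult_bounded[of f "\<lambda>_. c" "cmod c"]) auto

lemma L2_sum: "finite I \<Longrightarrow> (\<And>i. i \<in> I \<Longrightarrow> f i \<in> L2) \<Longrightarrow> (\<lambda>x. \<Sum>i\<in>I. f i x) \<in> L2"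
proof (induction I rule: finite_induct)
  case empty
  then show ?case by (simp add: L2_def)
next
  case (insert i I)
  then show ?case by (simp add: L2_add)
qed

text \<open>Makes integrability of an \<open>L2\<close> function over a box a case of
  \<open>L2_mult_integrable\<close>.\<close>

lemma L2_cbox_indicator: "(\<lambda>x. complex_of_real (indicator (cbox a b) x)) \<in> L2"
proof -
  have "integrable lborel (indicator (cbox a b) :: _ \<Rightarrow> real)"
    by (rule integrable_real_indicator) (use emeasure_lborel_cbox_finite[of a b] in \<open>auto simp: top.not_eq_extremum\<close>)
  moreover have "(\<lambda>x. (cmod (complex_of_real (indicator (cbox a b) x)))\<^sup>2) = indicator (cbox a b)"
    by (auto simp: indicator_def)
  ultimately show ?thesis by (simp add: L2_def)
qed

lemma test_measurable: "\<psi> \<in> test_functions \<Longrightarrow> \<psi> \<in> borel_measurable borel"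
  by (rule borel_measurable_continuous_onI[OF test_continuous])

lemma test_L2:
  assumes "\<psi> \<in> test_functions"
  shows "\<psi> \<in> L2"
proof -
  obtain C where C: "\<And>x. cmod (\<psi> x) \<le> C" using test_bounded[OF assms] by metis
  obtain a where a: "{x. \<psi> x \<noteq> 0} \<subseteq> cbox (- a) a"
    using bounded_subset_cbox_symmetric assms by (auto simp: test_functions_iff)
  have "(\<lambda>x. \<psi> x * complex_of_real (indicator (cbox (- a) a) x)) \<in> L2"
    by (rule L2_mult_bounded[OF L2_cbox_indicator test_measurable[OF assms] C])
  moreover have "(\<lambda>x. \<psi> x * complex_of_real (indicator (cbox (- a) a) x)) = \<psi>"
    using a by (auto simp: indicator_def fun_eq_iff)
  ultimately show ?thesis by simp
qed

section \<open>Smooth approximations of indicators of boxes\<close>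

lemma flat_1_bounds: "0 \<le> flat 1 s" "flat 1 s \<le> 1"
  by (auto simp: flat_def)

lemma flat_1_scaled_tendsto:
  "(\<lambda>m. flat 1 (real (Suc m) * s)) \<longlonglongrightarrow> (if s > 0 then 1 else 0)"
proof (cases "s > 0")
  case True
  have "(\<lambda>m. exp (- (inverse (real (Suc m)) * inverse s))) \<longlonglongrightarrow> exp (- (0 * inverse s))"
    by (intro tendsto_intros LIMSEQ_inverse_real_of_nat)
  moreover have "flat 1 (real (Suc m) * s) = exp (- (inverse (real (Suc m)) * inverse s))" for m
    using True by (simp add: flat_def zero_less_mult_iff)
  ultimately show ?thesis using True by simp
next
  case False
  then have "flat 1 (real (Suc m) * s) = 0" for m
    by (auto simp: flat_def zero_less_mult_iff)
  then show ?thesis using False by simp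
qed

text \<open>A left and a right edge. Both grow steeper with \<open>m\<close>, while the set where
  the product is nonzero is the same open interval for every \<open>m\<close>; hence one box
  dominates the whole sequence. \<open>Suc m\<close> keeps the scaling positive.\<close>

definition bump :: "real^'n \<Rightarrow> real^'n \<Rightarrow> nat \<Rightarrow> 'n \<Rightarrow> real \<Rightarrow> real" where
  "bump a b m i s = flat 1 (real (Suc m) * (s - a $ i)) * flat 1 (real (Suc m) * (b $ i - s))"

lemma smooth1_bump: "smooth1 (bump a b m i)"
proof -
  have "smooth1 (\<lambda>s. flat 1 (real (Suc m) * s + (- real (Suc m) * a $ i))
      * flat 1 (- real (Suc m) * s + real (Suc m) * b $ i))"
    by (intro smooth1.mult smooth1.flat)
  moreover have "bump a b m i = (\<lambda>s. flat 1 (real (Suc m) * s + (- real (Suc m) * a $ i))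
      * flat 1 (- real (Suc m) * s + real (Suc m) * b $ i))"
    by (simp add: bump_def fun_eq_iff algebra_simps)
  ultimately show ?thesis by simp
qed

lemma bump_bounds: "0 \<le> bump a b m i s" "bump a b m i s \<le> 1"
  using mult_mono[OF flat_1_bounds(2) flat_1_bounds(2)] flat_1_bounds by (auto simp: bump_def)

lemma bump_nonzero_iff: "bump a b m i s \<noteq> 0 \<longleftrightarrow> a $ i < s \<and> s < b $ i"
  by (auto simp: bump_def flat_def zero_less_mult_iff)

lemma tensor_bump_nonzero_iff: "tensor (bump a b m) x \<noteq> 0 \<longleftrightarrow> x \<in> box a b"
  by (simp add: tensor_def mem_box_cart bump_nonzero_iff)

lemma tensor_bump_test: "tensor (bump a b m) \<in> test_functions"
  by (simp add: test_functions_iff tensor_bump_nonzero_iff C_diff_tensor smooth1_bump)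

lemma norm_tensor_bump_le: "cmod (tensor (bump a b m) x) \<le> indicator (cbox a b) x"
proof (cases "x \<in> cbox a b")
  case True
  have "(\<Prod>i\<in>UNIV. bump a b m i (x $ i)) \<le> 1"
    by (intro prod_le_1 conjI bump_bounds)
  moreover have "0 \<le> (\<Prod>i\<in>UNIV. bump a b m i (x $ i))"
    by (intro prod_nonneg) (auto intro: bump_bounds)
  ultimately show ?thesis
    using True by (simp only: tensor_def norm_of_real indicator_simps abs_of_nonneg)
next
  case False
  then have "tensor (bump a b m) x = 0"
    using tensor_bump_nonzero_iff box_subset_cbox by blast
  then show ?thesis by simp
qed

lemma tensor_bump_tendsto: "(\<lambda>m. tensor (bump a b m) x) \<longlonglongrightarrow> indicator (box a b) x"
proof -
  have "(\<lambda>m. \<Prod>i\<in>UNIV. bump a b m i (x $ i)) \<longlonglongrightarrow>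
     (\<Prod>i\<in>UNIV. (if x $ i - a $ i > 0 then 1 else 0) * (if b $ i - x $ i > 0 then 1 else 0))"
    unfolding bump_def by (intro tendsto_prod tendsto_mult flat_1_scaled_tendsto)
  also have "(\<Prod>i\<in>UNIV. (if x $ i - a $ i > 0 then 1 else 0) * (if b $ i - x $ i > 0 then 1 else 0))
      = (indicator (box a b) x :: real)"
  proof (cases "x \<in> box a b")
    case True
    then show ?thesis by (simp add: mem_box_cart)
  next
    case False
    then obtain i where "\<not> (a $ i < x $ i \<and> x $ i < b $ i)" by (auto simp: mem_box_cart)
    then show ?thesis using False by (auto intro!: prod_zero)
  qed
  finally have "(\<lambda>m. complex_of_real (\<Prod>i\<in>UNIV. bump a b m i (x $ i))) \<longlonglongrightarrow> complex_of_real (indicator (box a b) x)"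
    by (rule tendsto_of_real)
  then show ?thesis by (cases "x \<in> box a b") (simp_all add: tensor_def)
qed

text \<open>
  The bumps fill up an open box, so the integral over every box vanishes; Lebesgue differentiation
  then applies.
\<close>

lemma AE_zero_if_tensor_integrals_zero:
  fixes F :: "real^'n \<Rightarrow> complex"
  assumes [measurable]: "F \<in> borel_measurable borel"
    and loc: "\<And>a b. integrable lborel (\<lambda>x. F x * complex_of_real (indicator (cbox a b) x))"
    and zero: "\<And>p. (\<And>i. smooth1 (p i)) \<Longrightarrow> tensor p \<in> test_functions \<Longrightarrow>
      (LINT x|lborel. F x * tensor p x) = 0"
  shows "AE x in lborel. F x = 0"
proof -
  have si: "set_integrable lborel (cbox a b) F" for a b
    using loc[of a b] unfolding set_integrable_def by (simp add: scaleR_conv_of_real mult.commute)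
  have int0: "integral (cbox a b) F = 0" for a b
  proof -
    have "(\<lambda>m. LINT x|lborel. F x * tensor (bump a b m) x) \<longlonglongrightarrow>
        (LINT x|lborel. F x * indicator (box a b) x)"
    proof (rule integral_dominated_convergence)
      show "integrable lborel (\<lambda>x. cmod (F x * complex_of_real (indicator (cbox a b) x)))"
        using loc[of a b] by (rule integrable_norm)
      show "AE x in lborel. (\<lambda>m. F x * tensor (bump a b m) x) \<longlonglongrightarrow> F x * indicator (box a b) x"
        by (intro AE_I2 tendsto_intros tensor_bump_tendsto)
      show "AE x in lborel. cmod (F x * tensor (bump a b m) x)
          \<le> cmod (F x * complex_of_real (indicator (cbox a b) x))" for m
        by (intro AE_I2) (auto simp: norm_mult intro!: mult_left_mono order_trans[OF norm_tensor_bump_le])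
      show "(\<lambda>x. F x * tensor (bump a b m) x) \<in> borel_measurable lborel" for m
        using test_measurable[OF tensor_bump_test[of a b m]] by measurable
    qed measurable
    moreover have "(LINT x|lborel. F x * tensor (bump a b m) x) = 0" for m
      by (rule zero) (simp_all add: smooth1_bump tensor_bump_test)
    ultimately have "(LINT x|lborel. F x * indicator (box a b) x) = 0"
      by (simp add: LIMSEQ_const_iff)
    moreover have "set_integrable lborel (box a b) F"
      using si[of a b] by (rule set_integrable_subset) (auto simp: box_subset_cbox)
    ultimately have "integral (box a b) F = 0"
      by (simp add: set_borel_integral_eq_integral(2)[symmetric] set_lebesgue_integral_def
          indicator_scaleR_eq_if mult.commute indicator_times_eq_if if_distrib)
    then show ?thesis by (simp add: integral_open_interval)
  qed
  have "F integrable_on cbox a b" for a b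
    using set_borel_integral_eq_integral(1)[OF si] .
  then obtain N where N: "negligible N"
    "\<And>x e. x \<notin> N \<Longrightarrow> 0 < e \<Longrightarrow> \<exists>d>0. \<forall>h. 0 < h \<and> h < d \<longrightarrow>
        norm (integral (cbox x (x + h *\<^sub>R One)) F /\<^sub>R h ^ DIM(real^'n) - F x) < e"
    using integrable_ccontinuous_explicit by metis
  have "F x = 0" if x: "x \<notin> N" for x
  proof (rule ccontr)
    assume "F x \<noteq> 0"
    \<comment> \<open>With the norm of F x as the admissible error, the vanishing of all averages
      over small cubes is already a contradiction.\<close>
    then obtain d where "d > 0" "\<forall>h. 0 < h \<and> h < d \<longrightarrow>
        norm (integral (cbox x (x + h *\<^sub>R One)) F /\<^sub>R h ^ DIM(real^'n) - F x) < norm (F x)"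
      using N(2)[OF x, of "norm (F x)"] by auto
    then have "norm (0 - F x) < norm (F x)"
      using int0 by (auto dest!: spec[of _ "d / 2"])
    then show False by simp
  qed
  then have "negligible {x \<in> space lborel. F x \<noteq> 0}"
    by (intro negligible_subset[OF N(1)]) auto
  \<comment> \<open>Negligible sets are null for the completed measure; this one is Borel, so it is
    null for \<open>lborel\<close> as well.\<close>
  then have "{x \<in> space lborel. F x \<noteq> 0} \<in> null_sets lborel"
    by (subst null_sets_completion_iff[symmetric]) (auto simp: negligible_iff_null_sets)
  then show ?thesis by (rule AE_I') auto
qed

section \<open>Weak derivatives along lines and integration by parts\<close>

lemma L2_diff_mult_integral:
  assumes "a \<in> L2" "b \<in> L2" "g \<in> L2"
  shows "(LINT x|lborel. (a x - b x) * g x) = (LINT x|lborel. a x * g x) - (LINT x|lborel. b x * g x)"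
  using assms by (simp add: left_diff_distrib L2_mult_integrable)

section \<open>Fubini's theorem on the product of a segment and the whole space\<close>

lemma slab_shift_integrable:
  fixes h :: "'a::euclidean_space \<Rightarrow> real"
  assumes h: "integrable lborel h" and pos: "\<And>x. 0 \<le> h x"
  shows "integrable (lborel \<Otimes>\<^sub>M lborel) (\<lambda>(s, x). indicator {0..t::real} s * h (x + s *\<^sub>R d))"
proof (rule lborel_pair.Fubini_integrable)
  have [measurable]: "h \<in> borel_measurable borel" using h by auto
  show "(\<lambda>(s, x). indicator {0..t} s * h (x + s *\<^sub>R d)) \<in> borel_measurable (lborel \<Otimes>\<^sub>M lborel)"
    by measurable
  \<comment> \<open>By translation invariance the integral over space is the same for every s, so
    only the indicator of a segment remains to be integrated.\<close>
  have "(LINT x|lborel. norm (indicator {0..t} s * h (x + s *\<^sub>R d))) = indicator {0..t} s * (LINT x|lborel. h x)" for s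
    using pos lborel_integral_shift[of h "s *\<^sub>R d"] by (simp add: abs_mult)
  moreover have "integrable lborel (\<lambda>s. indicator {0..t} s * (LINT x|lborel. h x))"
    by (intro integrable_mult_left integrable_real_indicator) (simp_all add: emeasure_lborel_Icc_eq)
  ultimately show "integrable lborel (\<lambda>s. LINT x|lborel. norm (case (s, x) of (s, x) \<Rightarrow> indicator {0..t} s * h (x + s *\<^sub>R d)))"
    by simp
  show "AE s in lborel. integrable lborel (\<lambda>x. case (s, x) of (s, x) \<Rightarrow> indicator {0..t} s * h (x + s *\<^sub>R d))"
    using lborel_integrable_shift[OF h] by simp
qed

lemma slab_pairing_integrable:
  assumes f: "f \<in> L2" and g: "g \<in> L2"
  shows "integrable (lborel \<Otimes>\<^sub>M lborel) (\<lambda>(s, x). indicator {0..t::real} s *\<^sub>R (f (x + s *\<^sub>R d) * g x))"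
proof (rule Bochner_Integration.integrable_bound)
  have [measurable]: "f \<in> borel_measurable borel" "g \<in> borel_measurable borel"
    using f g by (auto simp: L2_def)
  \<comment> \<open>The unshifted \<open>g\<close> is treated as a shift in direction 0, so the same
    lemma covers both squares.\<close>
  show "integrable (lborel \<Otimes>\<^sub>M lborel) (\<lambda>z. (case z of (s, x) \<Rightarrow> indicator {0..t} s * (cmod (f (x + s *\<^sub>R d)))\<^sup>2)
      + (case z of (s, x) \<Rightarrow> indicator {0..t} s * (cmod (g (x + s *\<^sub>R 0)))\<^sup>2))"
    by (intro Bochner_Integration.integrable_add slab_shift_integrable L2_square_integrable f g) auto
  show "(\<lambda>(s, x). indicator {0..t} s *\<^sub>R (f (x + s *\<^sub>R d) * g x)) \<in> borel_measurable (lborel \<Otimes>\<^sub>M lborel)"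
    by measurable
  show "AE z in lborel \<Otimes>\<^sub>M lborel.
      norm (case z of (s, x) \<Rightarrow> indicator {0..t} s *\<^sub>R (f (x + s *\<^sub>R d) * g x))
      \<le> norm ((case z of (s, x) \<Rightarrow> indicator {0..t} s * (cmod (f (x + s *\<^sub>R d)))\<^sup>2)
          + (case z of (s, x) \<Rightarrow> indicator {0..t} s * (cmod (g (x + s *\<^sub>R 0)))\<^sup>2))"
    by (intro AE_I2) (auto simp: indicator_def mult_le_sum_squares)
qed

lemma slab_pairing_swap:
  assumes f: "f \<in> L2" and g: "g \<in> L2"
  shows "(LINT x|lborel. (LINT s:{0..t::real}|lborel. f (x + s *\<^sub>R d)) * g x)
    = (LINT s:{0..t}|lborel. LINT x|lborel. f (x + s *\<^sub>R d) * g x)"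
proof -
  have "(LINT x|lborel. LINT s|lborel. indicator {0..t} s *\<^sub>R (f (x + s *\<^sub>R d) * g x))
      = (LINT s|lborel. LINT x|lborel. indicator {0..t} s *\<^sub>R (f (x + s *\<^sub>R d) * g x))"
    by (rule lborel_pair.Fubini_integral[OF slab_pairing_integrable[OF f g]])
  moreover have "(LINT s:{0..t}|lborel. f (x + s *\<^sub>R d)) * g x
      = (LINT s|lborel. indicator {0..t} s *\<^sub>R (f (x + s *\<^sub>R d) * g x))" for x
    by (simp add: set_lebesgue_integral_def flip: integral_mult_left_zero mult_scaleR_left)
  moreover have "(LINT x|lborel. indicator {0..t} s *\<^sub>R (f (x + s *\<^sub>R d) * g x))
      = indicator {0..t} s *\<^sub>R (LINT x|lborel. f (x + s *\<^sub>R d) * g x)" for s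
    by (rule integral_scaleR_right)
  ultimately show ?thesis
    by (simp only: set_lebesgue_integral_def)
qed

lemma slab_outer_integrable:
  assumes "f \<in> L2" "g \<in> L2"
  shows "set_integrable lborel {0..t::real} (\<lambda>s. LINT x|lborel. f (x + s *\<^sub>R d) * g x)"
  using lborel_pair.integrable_fst[OF slab_pairing_integrable[OF assms]]
  by (simp add: set_integrable_def)

lemma slab_inner_integrable:
  assumes "f \<in> L2" "g \<in> L2"
  shows "integrable lborel (\<lambda>x. (LINT s:{0..t::real}|lborel. f (x + s *\<^sub>R d)) * g x)"
  using lborel_pair.integrable_snd[OF slab_pairing_integrable[OF assms]]
  by (simp add: set_lebesgue_integral_def flip: integral_mult_left_zero mult_scaleR_left)

text \<open>Backward shifts occur because moving a shift from \<open>u'\<close> to the test function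
  reverses its sign; the chain rule then makes -\<psi> the primitive along the segment.\<close>

lemma test_line_FTC:
  assumes "\<psi> \<in> test_functions" "0 \<le> t"
  shows "(LINT s:{0..t}|lborel. partial j \<psi> (x - s *\<^sub>R axis j 1)) = \<psi> x - \<psi> (x - t *\<^sub>R axis j 1)"
proof -
  have deriv: "((\<lambda>s. - \<psi> (x - s *\<^sub>R axis j 1)) has_vector_derivative partial j \<psi> (x - s *\<^sub>R axis j 1)) (at s within {0..t})" for s
  proof -
    let ?y = "x - s *\<^sub>R axis j 1"
    interpret bounded_linear "frechet_derivative \<psi> (at ?y)"
      using has_derivative_frechet[OF test_differentiable[OF assms(1)]] by (rule has_derivative_bounded_linear)
    have "((\<lambda>s. \<psi> (x - s *\<^sub>R axis j 1)) has_derivative (\<lambda>h. frechet_derivative \<psi> (at ?y) (- (h *\<^sub>R axis j 1)))) (at s within {0..t})"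
      by (rule has_derivative_compose[where f="\<lambda>s. x - s *\<^sub>R axis j 1"])
        (auto intro!: derivative_eq_intros has_derivative_frechet test_differentiable[OF assms(1)])
    then have "((\<lambda>s. - \<psi> (x - s *\<^sub>R axis j 1)) has_derivative (\<lambda>h. - frechet_derivative \<psi> (at ?y) (- (h *\<^sub>R axis j 1)))) (at s within {0..t})"
      by (rule has_derivative_minus)
    then show ?thesis
      by (simp only: has_vector_derivative_def partial_def neg scaleR minus_minus)
  qed
  have "continuous_on {0..t} (\<lambda>s. partial j \<psi> (x - s *\<^sub>R axis j 1))"
    by (rule continuous_on_compose2[OF test_continuous[OF test_partial[OF assms(1)]]])
      (auto intro!: continuous_intros)
  from integral_FTC_atLeastAtMost[OF assms(2) deriv this] show ?thesis
    by (simp add: set_lebesgue_integral_def)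
qed

text \<open>Both sides are paired with a test function \<psi>. Fubini and a translation move the
  shift from \<open>u'\<close> to \<psi>, the weak derivative passes to \<psi>, the classical
  identity collapses the segment, and a last translation returns the shift to \<open>u\<close>.
  Agreement on all tensors is agreement almost everywhere.\<close>

lemma weak_partial_line_FTC:
  fixes u :: "real^'n \<Rightarrow> complex"
  assumes u: "u \<in> L2" and u': "u' \<in> L2" and weak: "is_weak_partial j u u'" and t: "0 \<le> t"
  shows "AE x in lborel. u (x + t *\<^sub>R axis j 1) - u x = (LINT s:{0..t}|lborel. u' (x + s *\<^sub>R axis j 1))"
proof -
  define e where "e = (axis j 1 :: real^'n)"
  define G where "G x = (LINT s:{0..t}|lborel. u' (x + s *\<^sub>R e))" for x
  have [measurable]: "u \<in> borel_measurable borel" "u' \<in> borel_measurable borel"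
    using u u' by (auto simp: L2_def)
  have G_meas [measurable]: "G \<in> borel_measurable borel"
  proof -
    have "(\<lambda>x. LINT s|lborel. indicator {0..t} s *\<^sub>R u' (x + s *\<^sub>R e)) \<in> borel_measurable borel"
      by (rule lborel.borel_measurable_lebesgue_integral) measurable
    then show ?thesis by (simp add: G_def[abs_def] set_lebesgue_integral_def)
  qed
  have ut: "(\<lambda>x. u (x + t *\<^sub>R e)) \<in> L2" using u by (rule L2_shift)
  have split: "(\<lambda>x. (u (x + t *\<^sub>R e) - u x - G x) * g x)
      = (\<lambda>x. u (x + t *\<^sub>R e) * g x - u x * g x - G x * g x)" for g
    by (simp add: algebra_simps)
  have int: "integrable lborel (\<lambda>x. u (x + t *\<^sub>R e) * g x)" "integrable lborel (\<lambda>x. u x * g x)"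
    "integrable lborel (\<lambda>x. G x * g x)" if "g \<in> L2" for g
    using u u' ut that slab_inner_integrable[OF u' that] by (auto simp: L2_mult_integrable G_def)
  have "AE x in lborel. u (x + t *\<^sub>R e) - u x - G x = 0"
  proof (rule AE_zero_if_tensor_integrals_zero)
    show "integrable lborel (\<lambda>x. (u (x + t *\<^sub>R e) - u x - G x) * complex_of_real (indicator (cbox a b) x))" for a b
      unfolding split by (intro Bochner_Integration.integrable_diff int L2_cbox_indicator)
    show "(LINT x|lborel. (u (x + t *\<^sub>R e) - u x - G x) * tensor p x) = 0"
      if "tensor p \<in> test_functions" for p
    proof -
      define \<psi> where "\<psi> = tensor p"
      have \<psi>: "\<psi> \<in> test_functions" using that by (simp add: \<psi>_def)
      then have [measurable]: "\<psi> \<in> borel_measurable borel" by (rule test_measurable)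
      have \<psi>L: "\<psi> \<in> L2" using \<psi> by (rule test_L2)
      have \<psi>t: "(\<lambda>x. \<psi> (x - t *\<^sub>R e)) \<in> L2"
        using L2_shift[OF \<psi>L, of "- (t *\<^sub>R e)"] by simp
      have "(LINT x|lborel. u' (x + s *\<^sub>R e) * \<psi> x)
          = - (LINT x|lborel. partial j \<psi> (x + s *\<^sub>R (- e)) * u x)" for s
      proof -
        have "(\<lambda>x. \<psi> (1 *\<^sub>R x + (- (s *\<^sub>R e)))) \<in> test_functions"
          using \<psi> by (rule test_affine) simp
        moreover have "partial j (\<lambda>x. \<psi> (1 *\<^sub>R x + (- (s *\<^sub>R e)))) = (\<lambda>x. partial j \<psi> (1 *\<^sub>R x + (- (s *\<^sub>R e))))"
          by (rule ext, subst partial_affine) (auto intro: test_differentiable[OF \<psi>])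
        ultimately have "(LINT x|lborel. u x * partial j \<psi> (x - s *\<^sub>R e)) = - (LINT x|lborel. u' x * \<psi> (x - s *\<^sub>R e))"
          using weak by (auto simp: is_weak_partial_def)
        moreover have "(LINT x|lborel. u' x * \<psi> (x - s *\<^sub>R e)) = (LINT x|lborel. u' (x + s *\<^sub>R e) * \<psi> x)"
          using lborel_integral_shift[of "\<lambda>x. u' x * \<psi> (x - s *\<^sub>R e)" "s *\<^sub>R e"] by simp
        ultimately show ?thesis by (simp add: mult.commute)
      qed
      then have "(LINT x|lborel. G x * \<psi> x)
          = - (LINT s:{0..t}|lborel. LINT x|lborel. partial j \<psi> (x + s *\<^sub>R (- e)) * u x)"
        unfolding G_def slab_pairing_swap[OF u' \<psi>L] by (simp add: set_lebesgue_integral_def)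
      also have "\<dots> = - (LINT x|lborel. (LINT s:{0..t}|lborel. partial j \<psi> (x + s *\<^sub>R (- e))) * u x)"
        using slab_pairing_swap[OF test_L2[OF test_partial[OF \<psi>, of j]] u, of t "- e"] by simp
      also have "\<dots> = - (LINT x|lborel. (\<psi> x - \<psi> (x - t *\<^sub>R e)) * u x)"
        using test_line_FTC[OF \<psi> t, where j=j] by (simp add: e_def)
      also have "\<dots> = (LINT x|lborel. u x * \<psi> (x - t *\<^sub>R e)) - (LINT x|lborel. u x * \<psi> x)"
        unfolding L2_diff_mult_integral[OF \<psi>L \<psi>t u] by (simp add: mult.commute)
      also have "(LINT x|lborel. u x * \<psi> (x - t *\<^sub>R e)) = (LINT x|lborel. u (x + t *\<^sub>R e) * \<psi> x)"
        using lborel_integral_shift[of "\<lambda>x. u x * \<psi> (x - t *\<^sub>R e)" "t *\<^sub>R e"] by simp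
      finally show ?thesis
        unfolding \<psi>_def[symmetric] split using int[OF \<psi>L] by simp
    qed
  qed measurable
  then show ?thesis by (auto simp: G_def e_def)
qed

section \<open>Increments of order t and integration by parts\<close>

lemma weak_partial_difference_pairing:
  fixes u :: "real^'n \<Rightarrow> complex"
  assumes u: "u \<in> L2" "u' \<in> L2" "is_weak_partial j u u'" and g: "g \<in> L2" and t: "0 \<le> t"
  shows "(LINT x|lborel. (u (x + t *\<^sub>R axis j 1) - u x) * g x)
    = (LINT s:{0..t}|lborel. LINT x|lborel. u' (x + s *\<^sub>R axis j 1) * g x)"
proof -
  have [measurable]: "u \<in> borel_measurable borel" "g \<in> borel_measurable borel"
    using u g by (auto simp: L2_def)
  have "(LINT x|lborel. (u (x + t *\<^sub>R axis j 1) - u x) * g x)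
      = (LINT x|lborel. (LINT s:{0..t}|lborel. u' (x + s *\<^sub>R axis j 1)) * g x)"
  proof (rule integral_cong_AE)
    show "AE x in lborel. (u (x + t *\<^sub>R axis j 1) - u x) * g x
        = (LINT s:{0..t}|lborel. u' (x + s *\<^sub>R axis j 1)) * g x"
      using weak_partial_line_FTC[OF u t] by eventually_elim simp
    show "(\<lambda>x. (LINT s:{0..t}|lborel. u' (x + s *\<^sub>R axis j 1)) * g x) \<in> borel_measurable lborel"
      using slab_inner_integrable[OF u(2) g] by (rule borel_measurable_integrable)
  qed measurable
  also have "\<dots> = (LINT s:{0..t}|lborel. LINT x|lborel. u' (x + s *\<^sub>R axis j 1) * g x)"
    by (rule slab_pairing_swap[OF u(2) g])
  finally show ?thesis .
qed

text \<open>Used in two ways: with \<alpha> = 0 for a bound of order t, and with \<alpha> the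
  unshifted pairing for an error of order t^2.\<close>

lemma norm_slice_average_le:
  fixes A :: "real \<Rightarrow> complex"
  assumes A: "set_integrable lborel {0..t} A" and t: "0 \<le> t"
    and le: "\<And>s. 0 \<le> s \<Longrightarrow> s \<le> t \<Longrightarrow> cmod (A s - \<alpha>) \<le> C"
  shows "cmod ((LINT s:{0..t}|lborel. A s) - of_real t * \<alpha>) \<le> t * C"
proof -
  have c: "set_integrable lborel {0..t} (\<lambda>s. \<alpha>)" "set_integrable lborel {0..t} (\<lambda>s. C)"
    by (simp_all add: set_integrable_def emeasure_lborel_Icc_eq)
  have "(LINT s:{0..t}|lborel. A s) - of_real t * \<alpha> = (LINT s:{0..t}|lborel. A s - \<alpha>)"
    using t by (simp add: set_integral_diff(2)[OF A c(1)]) (simp add: set_lebesgue_integral_def scaleR_conv_of_real)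
  also have "cmod \<dots> \<le> (LINT s:{0..t}|lborel. cmod (A s - \<alpha>))"
    by (rule set_integral_norm_bound[OF set_integral_diff(1)[OF A c(1)]])
  also have "\<dots> \<le> (LINT s:{0..t}|lborel. C)"
    by (rule set_integral_mono[OF set_integrable_norm[OF set_integral_diff(1)[OF A c(1)]] c(2)])
      (use le in auto)
  also have "\<dots> = t * C" using t by (simp add: set_lebesgue_integral_def)
  finally show ?thesis .
qed

abbreviation sqint :: "(real^'n \<Rightarrow> complex) \<Rightarrow> real" where
  "sqint f \<equiv> LINT x|lborel. (cmod (f x))\<^sup>2"

lemma sqint_shift: "f \<in> L2 \<Longrightarrow> (LINT x|lborel. (cmod (f (x + c)))\<^sup>2) = sqint f"
proof -
  assume "f \<in> L2"
  then have [measurable]: "f \<in> borel_measurable borel" by (simp add: L2_def)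
  show ?thesis by (rule lborel_integral_shift[of "\<lambda>x. (cmod (f x))\<^sup>2"]) measurable
qed

text \<open>Increments of a function with a weak derivative are of order t. No such rate is
  available for the derivative itself, which dictates how shifts are distributed in the integration
  by parts.\<close>

lemma weak_partial_difference_le:
  fixes u :: "real^'n \<Rightarrow> complex"
  assumes u: "u \<in> L2" "u' \<in> L2" "is_weak_partial j u u'" and g: "g \<in> L2" and t: "0 \<le> t"
  shows "cmod (LINT x|lborel. (u (x + t *\<^sub>R axis j 1) - u x) * g x) \<le> t * (sqint u' + sqint g)"
proof -
  have "cmod ((LINT s:{0..t}|lborel. LINT x|lborel. u' (x + s *\<^sub>R axis j 1) * g x) - of_real t * 0)
    \<le> t * (sqint u' + sqint g)"
  proof (rule norm_slice_average_le[OF slab_outer_integrable[OF u(2) g] t])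
    show "cmod ((LINT x|lborel. u' (x + s *\<^sub>R axis j 1) * g x) - 0) \<le> sqint u' + sqint g" for s
      using L2_mult_integral_le[OF L2_shift[OF u(2)] g, of "s *\<^sub>R axis j 1"] sqint_shift[OF u(2)] by simp
  qed
  then show ?thesis by (simp add: weak_partial_difference_pairing[OF u g t])
qed

text \<open>
  The integral of \<open>u v\<close> is translation invariant. Its vanishing increment over the step \<open>t\<close> is
  \<open>t\<close> times the left-hand side below, up to an error of order \<open>t\<^sup>2\<close>.
\<close>

lemma weak_partial_by_parts:
  fixes u v :: "real^'n \<Rightarrow> complex"
  assumes u: "u \<in> L2" "u' \<in> L2" "is_weak_partial j u u'"
    and v: "v \<in> L2" "v' \<in> L2" "is_weak_partial j v v'"
  shows "(LINT x|lborel. u' x * v x) + (LINT x|lborel. u x * v' x) = 0"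
proof -
  define e where "e = (axis j 1 :: real^'n)"
  define \<alpha> where "\<alpha> = (LINT x|lborel. u' x * v x)"
  define \<beta> where "\<beta> = (LINT x|lborel. v' x * u x)"
  define K where "K = sqint u' + sqint v'"
  have K: "0 \<le> K" by (simp add: K_def)
  have [measurable]: "u \<in> borel_measurable borel" "v \<in> borel_measurable borel"
    "u' \<in> borel_measurable borel" "v' \<in> borel_measurable borel"
    using u v by (auto simp: L2_def)
  have bound: "cmod (\<alpha> + \<beta>) \<le> 2 * t * K" if t: "0 < t" for t
  proof -
    have vt: "(\<lambda>x. v (x + t *\<^sub>R e)) \<in> L2" using v(1) by (rule L2_shift)
    \<comment> \<open>The increment of u v is the increment of u times the shifted v, plus the
      increment of v times the unshifted u. Hence v is taken at t in \<open>A\<close> and u at 0 in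
      \<open>B\<close>.\<close>
    define A where "A s = (LINT x|lborel. u' (x + s *\<^sub>R e) * v (x + t *\<^sub>R e))" for s
    define B where "B s = (LINT x|lborel. v' (x + s *\<^sub>R e) * u x)" for s
    have A: "cmod (A s - \<alpha>) \<le> t * K" if s: "0 \<le> s" "s \<le> t" for s
    proof -
      \<comment> \<open>Translating back by s frees \<open>u'\<close> of its shift, so the
        difference falls on v, whose increments are controlled.\<close>
      have "A s = (LINT x|lborel. v (x + (t - s) *\<^sub>R e) * u' x)"
        using lborel_integral_shift[of "\<lambda>x. v (x + (t - s) *\<^sub>R e) * u' x" "s *\<^sub>R e"]
        by (simp add: A_def algebra_simps)
      then have "A s - \<alpha> = (LINT x|lborel. (v (x + (t - s) *\<^sub>R e) - v x) * u' x)"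
        by (simp add: \<alpha>_def L2_diff_mult_integral L2_shift u v mult.commute[of "u' _"])
      moreover have "cmod (LINT x|lborel. (v (x + (t - s) *\<^sub>R e) - v x) * u' x) \<le> (t - s) * K"
        using weak_partial_difference_le[OF v u(2), of "t - s"] s by (simp add: e_def K_def add.commute)
      moreover have "(t - s) * K \<le> t * K" using s K by (intro mult_right_mono) auto
      ultimately show ?thesis by simp
    qed
    have B: "cmod (B s - \<beta>) \<le> t * K" if s: "0 \<le> s" "s \<le> t" for s
    proof -
      \<comment> \<open>Here \<beta> is shifted as a whole instead, so that the difference falls on
        u and \<open>v'\<close> enters only as a common factor.\<close>
      have "\<beta> = (LINT x|lborel. u (x + s *\<^sub>R e) * v' (x + s *\<^sub>R e))"
        using lborel_integral_shift[of "\<lambda>x. u x * v' x" "s *\<^sub>R e"] by (simp add: \<beta>_def mult.commute)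
      then have "\<beta> - B s = (LINT x|lborel. (u (x + s *\<^sub>R e) - u x) * v' (x + s *\<^sub>R e))"
        by (simp add: B_def L2_diff_mult_integral L2_shift u v mult.commute[of "v' _"])
      moreover have "cmod (LINT x|lborel. (u (x + s *\<^sub>R e) - u x) * v' (x + s *\<^sub>R e)) \<le> s * K"
        using weak_partial_difference_le[OF u L2_shift[OF v(2)], of s "s *\<^sub>R e"] s
        by (simp add: e_def K_def sqint_shift[OF v(2)])
      moreover have "s * K \<le> t * K" using s K by (intro mult_right_mono) auto
      ultimately show ?thesis by (simp add: norm_minus_commute)
    qed
    have "0 = (LINT x|lborel. u (x + t *\<^sub>R e) * v (x + t *\<^sub>R e)) - (LINT x|lborel. u x * v x)"
      using lborel_integral_shift[of "\<lambda>x. u x * v x" "t *\<^sub>R e"] by simp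
    also have "\<dots> = (LINT x|lborel. (u (x + t *\<^sub>R e) - u x) * v (x + t *\<^sub>R e))
        + (LINT x|lborel. (v (x + t *\<^sub>R e) - v x) * u x)"
      by (simp add: L2_diff_mult_integral L2_shift u v mult.commute[of "v _"])
    also have "\<dots> = (LINT s:{0..t}|lborel. A s) + (LINT s:{0..t}|lborel. B s)"
      using t weak_partial_difference_pairing[OF u vt] weak_partial_difference_pairing[OF v u(1)]
      by (simp add: A_def B_def e_def)
    finally have sum0: "(LINT s:{0..t}|lborel. A s) + (LINT s:{0..t}|lborel. B s) = 0" by simp
    have "cmod ((LINT s:{0..t}|lborel. A s) - of_real t * \<alpha>) \<le> t * (t * K)"
      using slab_outer_integrable[OF u(2) vt, of t e] t A
      by (intro norm_slice_average_le) (auto simp: A_def)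
    moreover have "cmod ((LINT s:{0..t}|lborel. B s) - of_real t * \<beta>) \<le> t * (t * K)"
      using slab_outer_integrable[OF v(2) u(1), of t e] t B
      by (intro norm_slice_average_le) (auto simp: B_def)
    ultimately have "cmod (((LINT s:{0..t}|lborel. A s) - of_real t * \<alpha>)
        + ((LINT s:{0..t}|lborel. B s) - of_real t * \<beta>)) \<le> t * (t * K) + t * (t * K)"
      by (rule norm_triangle_mono)
    also have "((LINT s:{0..t}|lborel. A s) - of_real t * \<alpha>) + ((LINT s:{0..t}|lborel. B s) - of_real t * \<beta>)
        = - (of_real t * (\<alpha> + \<beta>))"
      using sum0 by (simp add: algebra_simps)
    finally have "t * cmod (\<alpha> + \<beta>) \<le> t * (t * K) + t * (t * K)"
      using t by (simp only: norm_minus_cancel norm_mult norm_of_real abs_of_pos)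
    then have "t * cmod (\<alpha> + \<beta>) \<le> t * (2 * t * K)"
      by (simp add: algebra_simps)
    then show ?thesis using t by simp
  qed
  have "((\<lambda>t. 2 * t * K) \<longlongrightarrow> 2 * 0 * K) (at_right 0)"
    by (intro tendsto_intros)
  then have "cmod (\<alpha> + \<beta>) \<le> 2 * 0 * K"
    by (rule tendsto_lowerbound) (auto simp: eventually_at_filter bound)
  then show ?thesis by (simp add: \<alpha>_def \<beta>_def mult.commute)
qed

section \<open>The virial identity\<close>

lemma weak_partial_H1:
  assumes "f \<in> H1"
  shows "weak_partial j f \<in> L2" "is_weak_partial j f (weak_partial j f)"
proof -
  have "\<exists>g. g \<in> L2 \<and> is_weak_partial j f g" using assms by (auto simp: H1_def)
  then have "weak_partial j f \<in> L2 \<and> is_weak_partial j f (weak_partial j f)"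
    unfolding weak_partial_def by (rule someI_ex)
  then show "weak_partial j f \<in> L2" "is_weak_partial j f (weak_partial j f)" by auto
qed

text \<open>Integration by parts is bilinear while the scalar product conjugates its second
  argument. Conjugating the defining identity conjugates \<psi>, which stays a test
  function.\<close>

lemma is_weak_partial_cnj:
  assumes "is_weak_partial j f g"
  shows "is_weak_partial j (\<lambda>x. cnj (f x)) (\<lambda>x. cnj (g x))"
  unfolding is_weak_partial_def
proof
  fix \<psi> :: "real^'a \<Rightarrow> complex" assume \<psi>: "\<psi> \<in> test_functions"
  have "(LINT x|lborel. f x * partial j (\<lambda>x. cnj (\<psi> x)) x) = - (LINT x|lborel. g x * cnj (\<psi> x))"
    using assms test_cnj[OF \<psi>] by (auto simp: is_weak_partial_def)
  then have "(LINT x|lborel. f x * cnj (partial j \<psi> x)) = - (LINT x|lborel. g x * cnj (\<psi> x))"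
    by (simp add: partial_cnj test_differentiable[OF \<psi>])
  moreover have "(LINT x|lborel. cnj (f x) * partial j \<psi> x) = cnj (LINT x|lborel. f x * cnj (partial j \<psi> x))"
    by (subst Bochner_Integration.integral_cnj[symmetric]) simp
  moreover have "(LINT x|lborel. cnj (g x) * \<psi> x) = cnj (LINT x|lborel. g x * cnj (\<psi> x))"
    by (subst Bochner_Integration.integral_cnj[symmetric]) simp
  ultimately show "(LINT x|lborel. cnj (f x) * partial j \<psi> x) = - (LINT x|lborel. cnj (g x) * \<psi> x)"
    by simp
qed

text \<open>Testing the product with \<psi> is testing f with \<eta> \<psi>; the classical Leibniz
  rule sorts the terms.\<close>

lemma is_weak_partial_test_mult:
  assumes f: "f \<in> L2" "g \<in> L2" "is_weak_partial j f g" and \<eta>: "\<eta> \<in> test_functions"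
  shows "is_weak_partial j (\<lambda>x. \<eta> x * f x) (\<lambda>x. \<eta> x * g x + partial j \<eta> x * f x)"
  unfolding is_weak_partial_def
proof
  fix \<psi> :: "real^'a \<Rightarrow> complex" assume \<psi>: "\<psi> \<in> test_functions"
  note L = test_L2[OF test_mult[OF \<eta> \<psi>]] test_L2[OF test_mult[OF \<eta> test_partial[OF \<psi>]]]
    test_L2[OF test_mult[OF test_partial[OF \<eta>] \<psi>]]
  have "partial j (\<lambda>x. \<eta> x * \<psi> x) = (\<lambda>x. \<eta> x * partial j \<psi> x + partial j \<eta> x * \<psi> x)"
    by (rule ext, rule partial_mult) (auto intro: test_differentiable \<eta> \<psi>)
  then have "(LINT x|lborel. f x * (\<eta> x * partial j \<psi> x + partial j \<eta> x * \<psi> x))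
      = - (LINT x|lborel. g x * (\<eta> x * \<psi> x))"
    using f(3) test_mult[OF \<eta> \<psi>] by (auto simp: is_weak_partial_def)
  moreover have "(LINT x|lborel. f x * (\<eta> x * partial j \<psi> x + partial j \<eta> x * \<psi> x))
      = (LINT x|lborel. f x * (\<eta> x * partial j \<psi> x)) + (LINT x|lborel. f x * (partial j \<eta> x * \<psi> x))"
    by (simp add: distrib_left L2_mult_integrable f L)
  moreover have "(LINT x|lborel. (\<eta> x * g x + partial j \<eta> x * f x) * \<psi> x)
      = (LINT x|lborel. g x * (\<eta> x * \<psi> x) + f x * (partial j \<eta> x * \<psi> x))"
    by (simp add: algebra_simps)
  moreover have "\<dots> = (LINT x|lborel. g x * (\<eta> x * \<psi> x)) + (LINT x|lborel. f x * (partial j \<eta> x * \<psi> x))"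
    by (simp add: L2_mult_integrable f L)
  ultimately have "(LINT x|lborel. f x * (\<eta> x * partial j \<psi> x))
      = - (LINT x|lborel. (\<eta> x * g x + partial j \<eta> x * f x) * \<psi> x)"
    by (simp add: eq_diff_eq)
  then show "(LINT x|lborel. \<eta> x * f x * partial j \<psi> x)
      = - (LINT x|lborel. (\<eta> x * g x + partial j \<eta> x * f x) * \<psi> x)"
    by (simp add: mult.assoc mult.left_commute)
qed

text \<open>Both functions represent the same distribution: the two derivatives pass to the tensor,
  where they commute.\<close>

lemma weak_partials_commute:
  fixes \<phi> :: "real^'n \<Rightarrow> complex"
  assumes "is_weak_partial j \<phi> gj" "is_weak_partial k \<phi> gk"
    and "hjk \<in> L2" "is_weak_partial j gk hjk" and "hkj \<in> L2" "is_weak_partial k gj hkj"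
  shows "AE x in lborel. hjk x = hkj x"
proof -
  have [measurable]: "hjk \<in> borel_measurable borel" "hkj \<in> borel_measurable borel"
    using assms by (auto simp: L2_def)
  have "AE x in lborel. hjk x - hkj x = 0"
  proof (rule AE_zero_if_tensor_integrals_zero)
    show "integrable lborel (\<lambda>x. (hjk x - hkj x) * complex_of_real (indicator (cbox a b) x))" for a b
      using assms by (simp add: left_diff_distrib L2_mult_integrable L2_cbox_indicator)
    show "(LINT x|lborel. (hjk x - hkj x) * tensor p x) = 0"
      if p: "\<And>i. smooth1 (p i)" and test: "tensor p \<in> test_functions" for p
    proof -
      have "(LINT x|lborel. hjk x * tensor p x) = (LINT x|lborel. \<phi> x * partial k (partial j (tensor p)) x)"
        using assms test test_partial[OF test] by (simp add: is_weak_partial_def)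
      moreover have "(LINT x|lborel. hkj x * tensor p x) = (LINT x|lborel. \<phi> x * partial j (partial k (tensor p)) x)"
        using assms test test_partial[OF test] by (simp add: is_weak_partial_def)
      moreover have "partial j (partial k (tensor p)) = partial k (partial j (tensor p))"
        using p by (rule partial_tensor_commute)
      ultimately show ?thesis
        using assms test_L2[OF test] by (simp add: L2_diff_mult_integral)
    qed
  qed measurable
  then show ?thesis by simp
qed

text \<open>Moving the derivative off \<open>hjj\<close> produces the term with
  \<open>partial j \<eta>\<close> and the integral of \<eta> \<open>hjk\<close> times the conjugate
  of \<open>gj\<close>. There \<open>hjk\<close> may be replaced by \<open>hkj\<close>, and the real
  part becomes \<eta> times half the k-th derivative of |gj|^2; a second integration by parts gives
  the term with the factor 1 / 2.\<close>

lemma weighted_by_parts: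
  fixes gj gk :: "real^'n \<Rightarrow> complex"
  assumes \<eta>: "\<eta> \<in> test_functions" "\<And>x. cnj (\<eta> x) = \<eta> x"
    and gj: "gj \<in> L2" and gk: "gk \<in> L2"
    and hjj: "hjj \<in> L2" "is_weak_partial j gj hjj"
    and hjk: "hjk \<in> L2" "is_weak_partial j gk hjk"
    and hkj: "hkj \<in> L2" "is_weak_partial k gj hkj"
    and comm: "AE x in lborel. hjk x = hkj x"
  shows "Re (LINT x|lborel. \<eta> x * (gk x * cnj (hjj x)))
    = Re (LINT x|lborel. partial k \<eta> x * (gj x * cnj (gj x))) / 2
      - Re (LINT x|lborel. partial j \<eta> x * (gk x * cnj (gj x)))"
proof -
  obtain C where C: "\<And>x. cmod (\<eta> x) \<le> C" using test_bounded[OF \<eta>(1)] by metis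
  have \<eta>L: "(\<lambda>x. \<eta> x * f x) \<in> L2" if "f \<in> L2" for f
    using that test_measurable[OF \<eta>(1)] C by (rule L2_mult_bounded)
  have \<eta>'L: "(\<lambda>x. partial i \<eta> x * f x) \<in> L2" if "f \<in> L2" for f i
  proof -
    obtain C where "\<And>x. cmod (partial i \<eta> x) \<le> C" using test_bounded[OF test_partial[OF \<eta>(1)]] by metis
    then show ?thesis using that test_measurable[OF test_partial[OF \<eta>(1)]] by (intro L2_mult_bounded)
  qed
  have [measurable]: "hjk \<in> borel_measurable borel" "hkj \<in> borel_measurable borel"
    "gj \<in> borel_measurable borel" "\<eta> \<in> borel_measurable borel"
    using assms by (auto simp: L2_def test_measurable)
  have parts: "(LINT x|lborel. \<eta> x * h x * cnj (gj x)) + (LINT x|lborel. partial i \<eta> x * f x * cnj (gj x))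
      + (LINT x|lborel. \<eta> x * f x * cnj (h' x)) = 0"
    if f: "f \<in> L2" "h \<in> L2" "is_weak_partial i f h" and h': "h' \<in> L2" "is_weak_partial i gj h'" for f h h' i
  proof -
    have "(LINT x|lborel. (\<eta> x * h x + partial i \<eta> x * f x) * cnj (gj x)) + (LINT x|lborel. \<eta> x * f x * cnj (h' x)) = 0"
      by (intro weak_partial_by_parts[where j=i] L2_cnj L2_add \<eta>L \<eta>'L is_weak_partial_cnj
          is_weak_partial_test_mult f h' gj \<eta>(1))
    then show ?thesis by (simp add: distrib_right L2_mult_integrable L2_cnj \<eta>L \<eta>'L f h' gj)
  qed
  define S where "S = (LINT x|lborel. \<eta> x * hkj x * cnj (gj x))"
  \<comment> \<open>Reality of \<eta> enters here: the two terms of the product rule are conjugate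
    to each other and add up to 2 Re S.\<close>
  have "(LINT x|lborel. \<eta> x * gj x * cnj (hkj x)) = cnj S"
    unfolding S_def by (subst Bochner_Integration.integral_cnj[symmetric]) (simp add: \<eta>(2) ac_simps)
  then have "S + (LINT x|lborel. partial k \<eta> x * gj x * cnj (gj x)) + cnj S = 0"
    using parts[OF gj hkj hkj] by (simp add: S_def)
  from arg_cong[OF this, of Re]
  have 1: "2 * Re S = - Re (LINT x|lborel. partial k \<eta> x * gj x * cnj (gj x))" by simp
  have "(LINT x|lborel. \<eta> x * hjk x * cnj (gj x)) = S"
    unfolding S_def
  proof (rule integral_cong_AE)
    show "AE x in lborel. \<eta> x * hjk x * cnj (gj x) = \<eta> x * hkj x * cnj (gj x)"
      using comm by eventually_elim simp
  qed (use L2_mult_integrable[OF \<eta>L[OF hjk(1)] L2_cnj[OF gj]] L2_mult_integrable[OF \<eta>L[OF hkj(1)] L2_cnj[OF gj]] in auto)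
  then have "S + (LINT x|lborel. partial j \<eta> x * gk x * cnj (gj x)) + (LINT x|lborel. \<eta> x * gk x * cnj (hjj x)) = 0"
    using parts[OF gk hjk hjj] by simp
  from arg_cong[OF this, of Re] 1 show ?thesis by (simp add: mult.assoc)
qed

section \<open>Cutoff weights for the field x\<close>

lemma C_diff_coordinate: "C_diff m (\<lambda>x. complex_of_real (x $ k))"
  and partial_coordinate: "partial j (\<lambda>x. complex_of_real (x $ k)) = (\<lambda>x. if j = k then 1 else 0)"
  and coordinate_differentiable: "(\<lambda>x. complex_of_real (x $ k)) differentiable (at x)"
proof -
  have d: "((\<lambda>x. complex_of_real (x $ k)) has_derivative (\<lambda>x. complex_of_real (x $ k))) (at x)" for x
    by (intro has_derivative_of_real bounded_linear_imp_has_derivative bounded_linear_vec_nth)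
  show p: "partial j (\<lambda>x. complex_of_real (x $ k)) = (\<lambda>x. if j = k then 1 else 0)" for j
    by (rule ext, subst partial_eqI[OF d]) (simp add: axis_def)
  show e: "(\<lambda>x. complex_of_real (x $ k)) differentiable (at x)" for x
    using d by (auto simp: differentiable_def)
  show "C_diff m (\<lambda>x. complex_of_real (x $ k))"
  proof (cases m)
    case 0
    then show ?thesis by (auto intro!: continuous_intros)
  next
    case (Suc n)
    then show ?thesis using e by (simp add: p C_diff_const)
  qed
qed

text \<open>Dilation flattens \<zeta> to its value at the origin without changing its bound. It is
  applied to the cutoff and to the derivatives of the weights.\<close>

lemma integral_dilation_tendsto:
  fixes \<zeta> F :: "real^'n \<Rightarrow> complex"
  assumes \<zeta>: "\<zeta> \<in> test_functions" and F: "integrable lborel F"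
  shows "(\<lambda>m. LINT x|lborel. \<zeta> (inverse (real (Suc m)) *\<^sub>R x) * F x) \<longlonglongrightarrow> \<zeta> 0 * (LINT x|lborel. F x)"
proof -
  obtain C where C: "\<And>x. cmod (\<zeta> x) \<le> C" using test_bounded[OF \<zeta>] by metis
  have [measurable]: "\<zeta> \<in> borel_measurable borel" "F \<in> borel_measurable borel"
    using test_measurable[OF \<zeta>] F by auto
  have "(\<lambda>m. LINT x|lborel. \<zeta> (inverse (real (Suc m)) *\<^sub>R x) * F x) \<longlonglongrightarrow> (LINT x|lborel. \<zeta> 0 * F x)"
  proof (rule integral_dominated_convergence)
    show "integrable lborel (\<lambda>x. C * cmod (F x))" using F by simp
    have lim: "(\<lambda>m. \<zeta> (inverse (real (Suc m)) *\<^sub>R x)) \<longlonglongrightarrow> \<zeta> 0" for x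
    proof -
      have "(\<lambda>m. inverse (real (Suc m)) *\<^sub>R x) \<longlonglongrightarrow> 0 *\<^sub>R x"
        by (intro tendsto_intros LIMSEQ_inverse_real_of_nat)
      moreover have "isCont \<zeta> 0" using test_continuous[OF \<zeta>] by (simp add: continuous_on_eq_continuous_at)
      ultimately show ?thesis using isCont_tendsto_compose by fastforce
    qed
    show "AE x in lborel. (\<lambda>m. \<zeta> (inverse (real (Suc m)) *\<^sub>R x) * F x) \<longlonglongrightarrow> \<zeta> 0 * F x"
      by (intro AE_I2 tendsto_mult lim tendsto_const)
    show "AE x in lborel. cmod (\<zeta> (inverse (real (Suc m)) *\<^sub>R x) * F x) \<le> C * cmod (F x)" for m
      by (intro AE_I2) (simp only: norm_mult mult_right_mono[OF C norm_ge_zero])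
  qed measurable
  then show ?thesis by simp
qed

text \<open>
  For smooth \<open>\<phi>\<close> this is integration by parts against \<open>x\<close>. The weights \<open>x\<^sub>k \<kappa>(c x)\<close> replace
  \<open>x\<^sub>k\<close>: their derivatives are dilations of fixed test functions, hence converge boundedly as
  \<open>c \<rightarrow> 0\<close>.
\<close>

lemma virial_identity:
  fixes \<phi> :: "real^'n \<Rightarrow> complex"
  assumes g: "\<And>k. g k \<in> L2" "\<And>k. is_weak_partial k \<phi> (g k)"
    and h: "\<And>j k. h j k \<in> L2" "\<And>j k. is_weak_partial j (g k) (h j k)"
    and xg: "(\<lambda>x. \<Sum>k\<in>UNIV. complex_of_real (x $ k) * g k x) \<in> L2"
  shows "Re (LINT x|lborel. (\<Sum>k\<in>UNIV. complex_of_real (x $ k) * g k x) * cnj (\<Sum>j\<in>UNIV. h j j x))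
    = (real CARD('n) / 2 - 1) * (\<Sum>j\<in>UNIV. sqint (g j))"
proof -
  \<comment> \<open>A real cutoff living on the cube with corners -1 and 1. Its value at the origin
    is exp(-2 n) rather than 1; this factor \<open>a\<close> is cancelled at the end.\<close>
  define \<kappa> where "\<kappa> = tensor (bump (- 1) (1 :: real^'n) 0)"
  define a where "a = Re (\<kappa> 0)"
  have \<kappa>: "\<kappa> \<in> test_functions" by (simp add: \<kappa>_def tensor_bump_test)
  have \<kappa>_real: "cnj (\<kappa> x) = \<kappa> x" for x by (simp add: \<kappa>_def tensor_def)
  have "\<kappa> 0 \<noteq> 0" unfolding \<kappa>_def tensor_bump_nonzero_iff by (simp add: mem_box_cart)
  moreover have \<kappa>0: "\<kappa> 0 = complex_of_real a" by (simp add: a_def \<kappa>_def tensor_def)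
  ultimately have a: "a \<noteq> 0" by simp
  define \<eta> where "\<eta> k = (\<lambda>x. complex_of_real (x $ k) * \<kappa> x)" for k
  have \<eta>: "\<eta> k \<in> test_functions" for k
    using \<kappa> by (auto simp: test_functions_iff \<eta>_def C_diff_mult C_diff_coordinate elim: bounded_subset)
  \<comment> \<open>At the origin the coordinate vanishes, so only its derivative contributes: the
    Jacobian of x times the value of the cutoff.\<close>
  have \<eta>'0: "partial j (\<eta> k) 0 = (if j = k then \<kappa> 0 else 0)" for j k
    unfolding \<eta>_def
    by (subst partial_mult) (auto simp: coordinate_differentiable test_differentiable[OF \<kappa>] partial_coordinate)
  define c where "c m = inverse (real (Suc m))" for m
  have c: "c m \<noteq> 0" for m by (simp add: c_def)
  let ?xg = "\<lambda>x. \<Sum>k\<in>UNIV. complex_of_real (x $ k) * g k x"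
  let ?L = "\<lambda>x. \<Sum>j\<in>UNIV. h j j x"
  define W where "W m k = (\<lambda>x. complex_of_real (x $ k) * \<kappa> (c m *\<^sub>R x))" for m k
  \<comment> \<open>As 1 / c times a dilate of \<eta>, the weight has a derivative in which the
    chain-rule factor c cancels, so its bound does not depend on m.\<close>
  have W_eq: "W m k = (\<lambda>x. complex_of_real (inverse (c m)) * \<eta> k (c m *\<^sub>R x + 0))" for m k
    using c[of m] by (simp add: W_def \<eta>_def fun_eq_iff)
  have W: "W m k \<in> test_functions" for m k
    unfolding W_eq using c[of m] by (intro test_cmult test_affine \<eta>)
  have W': "partial j (W m k) x = partial j (\<eta> k) (c m *\<^sub>R x)" for m j k x
  proof -
    have d: "(\<lambda>x. \<eta> k (c m *\<^sub>R x + 0)) differentiable (at x)"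
      using c[of m] by (intro test_differentiable test_affine \<eta>)
    have "partial j (W m k) x = complex_of_real (inverse (c m)) * partial j (\<lambda>x. \<eta> k (c m *\<^sub>R x + 0)) x"
      unfolding W_eq by (subst partial_mult[OF _ d]) (auto simp: partial_eqI[OF has_derivative_const])
    also have "\<dots> = complex_of_real (inverse (c m)) * (complex_of_real (c m) * partial j (\<eta> k) (c m *\<^sub>R x + 0))"
      by (subst partial_affine) (auto intro: test_differentiable \<eta>)
    finally show ?thesis using c[of m] by simp
  qed
  have step: "Re (LINT x|lborel. W m k x * (g k x * cnj (h j j x)))
      = Re (LINT x|lborel. partial k (\<eta> k) (c m *\<^sub>R x) * (g j x * cnj (g j x))) / 2
        - Re (LINT x|lborel. partial j (\<eta> k) (c m *\<^sub>R x) * (g k x * cnj (g j x)))" for m j k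
  proof -
    have "cnj (W m k x) = W m k x" for x by (simp add: W_def \<kappa>_real)
    moreover have "AE x in lborel. h j k x = h k j x"
      by (rule weak_partials_commute) (rule g h)+
    ultimately have "Re (LINT x|lborel. W m k x * (g k x * cnj (h j j x)))
      = Re (LINT x|lborel. partial k (W m k) x * (g j x * cnj (g j x))) / 2
        - Re (LINT x|lborel. partial j (W m k) x * (g k x * cnj (g j x)))"
      by (intro weighted_by_parts[where hjk="h j k" and hkj="h k j"] W g h)
    then show ?thesis by (simp add: W')
  qed
  have WL: "(\<lambda>x. W m k x * g k x) \<in> L2" for m k
  proof -
    obtain C where "\<And>x. cmod (W m k x) \<le> C" using test_bounded[OF W] by metis
    then show ?thesis by (intro L2_mult_bounded g test_measurable W)
  qed
  \<comment> \<open>Summing over k reassembles x . grad \<phi>. For fixed m the sums leave the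
    integral because every \<open>W m k\<close> is bounded.\<close>
  have "Re (LINT x|lborel. \<kappa> (c m *\<^sub>R x) * (?xg x * cnj (?L x)))
      = (\<Sum>j\<in>UNIV. \<Sum>k\<in>UNIV. Re (LINT x|lborel. partial k (\<eta> k) (c m *\<^sub>R x) * (g j x * cnj (g j x))) / 2
        - Re (LINT x|lborel. partial j (\<eta> k) (c m *\<^sub>R x) * (g k x * cnj (g j x))))" for m
  proof -
    have "\<kappa> (c m *\<^sub>R x) * (?xg x * cnj (?L x)) = (\<Sum>j\<in>UNIV. \<Sum>k\<in>UNIV. W m k x * g k x * cnj (h j j x))" for x
    proof -
      have "\<kappa> (c m *\<^sub>R x) * ?xg x = (\<Sum>k\<in>UNIV. W m k x * g k x)"
        by (simp add: W_def sum_distrib_left ac_simps)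
      then have "\<kappa> (c m *\<^sub>R x) * (?xg x * cnj (?L x)) = (\<Sum>k\<in>UNIV. W m k x * g k x) * (\<Sum>j\<in>UNIV. cnj (h j j x))"
        by (simp add: mult.assoc[symmetric])
      also have "\<dots> = (\<Sum>k\<in>UNIV. \<Sum>j\<in>UNIV. W m k x * g k x * cnj (h j j x))"
        by (rule sum_product)
      also have "\<dots> = (\<Sum>j\<in>UNIV. \<Sum>k\<in>UNIV. W m k x * g k x * cnj (h j j x))"
        by (rule sum.swap)
      finally show ?thesis .
    qed
    then have "(LINT x|lborel. \<kappa> (c m *\<^sub>R x) * (?xg x * cnj (?L x)))
        = (\<Sum>j\<in>UNIV. \<Sum>k\<in>UNIV. LINT x|lborel. W m k x * g k x * cnj (h j j x))"
      by (simp add: Bochner_Integration.integral_sum Bochner_Integration.integrable_sum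
          L2_mult_integrable[OF WL L2_cnj[OF h(1)]])
    then show ?thesis by (simp add: step[symmetric] mult.assoc)
  qed
  \<comment> \<open>This limit uses \<open>xg\<close> for the whole sum; the single terms have no
    evident integrable majorant.\<close>
  moreover have "(\<lambda>m. Re (LINT x|lborel. \<kappa> (c m *\<^sub>R x) * (?xg x * cnj (?L x))))
      \<longlonglongrightarrow> Re (\<kappa> 0 * (LINT x|lborel. ?xg x * cnj (?L x)))"
    unfolding c_def
    by (intro tendsto_Re integral_dilation_tendsto \<kappa> L2_mult_integrable xg L2_cnj L2_sum h) simp
  moreover have "(\<lambda>m. \<Sum>j\<in>UNIV. \<Sum>k\<in>UNIV. Re (LINT x|lborel. partial k (\<eta> k) (c m *\<^sub>R x) * (g j x * cnj (g j x))) / 2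
        - Re (LINT x|lborel. partial j (\<eta> k) (c m *\<^sub>R x) * (g k x * cnj (g j x))))
      \<longlonglongrightarrow> (\<Sum>j\<in>UNIV. \<Sum>k\<in>UNIV. Re (partial k (\<eta> k) 0 * (LINT x|lborel. g j x * cnj (g j x))) / 2
        - Re (partial j (\<eta> k) 0 * (LINT x|lborel. g k x * cnj (g j x))))"
    unfolding c_def
    by (intro tendsto_sum tendsto_diff tendsto_divide tendsto_const tendsto_Re integral_dilation_tendsto
        test_partial \<eta> L2_mult_integrable g L2_cnj) simp
  ultimately have "Re (\<kappa> 0 * (LINT x|lborel. ?xg x * cnj (?L x)))
     = (\<Sum>j\<in>UNIV. \<Sum>k\<in>UNIV. Re (partial k (\<eta> k) 0 * (LINT x|lborel. g j x * cnj (g j x))) / 2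
        - Re (partial j (\<eta> k) 0 * (LINT x|lborel. g k x * cnj (g j x))))"
    by (simp add: LIMSEQ_unique)
  moreover have "Re (LINT x|lborel. g j x * cnj (g j x)) = sqint (g j)" for j
  proof -
    have "(LINT x|lborel. g j x * cnj (g j x)) = (LINT x|lborel. complex_of_real ((cmod (g j x))\<^sup>2))"
      by (simp only: complex_norm_square)
    then show ?thesis by (simp only: integral_complex_of_real Re_complex_of_real)
  qed
  \<comment> \<open>The diagonal derivatives add up to n a, which the factor 1 / 2 turns into n a /
    2; in the second term only k = j survives and gives -a.\<close>
  moreover have "(\<Sum>k\<in>UNIV. Re (partial k (\<eta> k) 0 * (LINT x|lborel. g j x * cnj (g j x))) / 2
        - Re (partial j (\<eta> k) 0 * (LINT x|lborel. g k x * cnj (g j x))))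
      = a * (real CARD('n) / 2 - 1) * Re (LINT x|lborel. g j x * cnj (g j x))" for j
  proof -
    have "(\<Sum>k\<in>UNIV. Re (partial j (\<eta> k) 0 * (LINT x|lborel. g k x * cnj (g j x))))
        = (\<Sum>k\<in>UNIV. if j = k then a * Re (LINT x|lborel. g j x * cnj (g j x)) else 0)"
      by (rule sum.cong) (auto simp: \<eta>'0 \<kappa>0)
    then show ?thesis
      by (simp only: sum_subtractf) (simp add: \<eta>'0 \<kappa>0 algebra_simps)
  qed
  ultimately have "a * Re (LINT x|lborel. ?xg x * cnj (?L x))
      = a * ((real CARD('n) / 2 - 1) * (\<Sum>j\<in>UNIV. sqint (g j)))"
    by (simp add: \<kappa>0 sum_distrib_left mult.assoc)
  then show ?thesis using a by simp
qed

section \<open>The commutator identity\<close>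

lemma l2_norm_square: "(l2_norm f)\<^sup>2 = sqint f"
  by (simp add: l2_norm_def)

lemma l2_inner_self: "l2_inner f f = complex_of_real (sqint f)"
  by (simp only: l2_inner_def complex_norm_square[symmetric] integral_complex_of_real)

lemma l2_inner_commute: "l2_inner g f = cnj (l2_inner f g)"
  unfolding l2_inner_def by (subst Bochner_Integration.integral_cnj[symmetric]) (simp add: mult.commute)

lemma l2_norm_pos:
  assumes "f \<in> L2" "\<not> l2_zero f"
  shows "0 < l2_norm f"
proof -
  have "sqint f \<noteq> 0"
    using assms integral_nonneg_eq_0_iff_AE[OF L2_square_integrable[OF assms(1)]]
    by (auto simp: l2_zero_def)
  then show ?thesis by (simp add: l2_norm_def order_less_le)
qed

text \<open>Expand the square: normalization makes each diagonal term 1, and Re (a cnj (i b)) = Im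
  (a cnj b) identifies the cross term as 2 Im (a | b) divided by both norms.\<close>

lemma l2_norm_normalized_sum:
  assumes a: "a \<in> L2" "\<not> l2_zero a" and b: "b \<in> L2" "\<not> l2_zero b"
  shows "l2_norm a * l2_norm b *
      (2 - (l2_norm (\<lambda>x. a x / complex_of_real (l2_norm a) + \<i> * (b x / complex_of_real (l2_norm b))))\<^sup>2)
    = - 2 * Im (l2_inner a b)"
proof -
  define \<alpha> where "\<alpha> = l2_norm a"
  define \<beta> where "\<beta> = l2_norm b"
  have pos: "0 < \<alpha>" "0 < \<beta>" using assms by (auto simp: \<alpha>_def \<beta>_def l2_norm_pos)
  have ab: "integrable lborel (\<lambda>x. a x * cnj (b x))"
    using a b by (intro L2_mult_integrable L2_cnj)
  define I where "I x = Im (a x * cnj (b x))" for x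
  have I: "integrable lborel I" "(LINT x|lborel. I x) = Im (l2_inner a b)"
    using integrable_Im[OF ab] integral_Im[OF ab] by (simp_all only: I_def[abs_def] l2_inner_def)
  have "(cmod (a x / complex_of_real \<alpha> + \<i> * (b x / complex_of_real \<beta>)))\<^sup>2
      = (cmod (a x))\<^sup>2 / \<alpha>\<^sup>2 + (cmod (b x))\<^sup>2 / \<beta>\<^sup>2 + 2 / (\<alpha> * \<beta>) * I x" for x
    using pos unfolding cmod_power2 I_def
    by (simp add: Re_divide_of_real Im_divide_of_real) (simp add: field_simps power2_eq_square)
  then have "(l2_norm (\<lambda>x. a x / complex_of_real \<alpha> + \<i> * (b x / complex_of_real \<beta>)))\<^sup>2
      = (LINT x|lborel. (cmod (a x))\<^sup>2 / \<alpha>\<^sup>2 + (cmod (b x))\<^sup>2 / \<beta>\<^sup>2 + 2 / (\<alpha> * \<beta>) * I x)"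
    by (simp only: l2_norm_square)
  also have "\<dots> = sqint a / \<alpha>\<^sup>2 + sqint b / \<beta>\<^sup>2 + 2 / (\<alpha> * \<beta>) * Im (l2_inner a b)"
    using a b I by (simp add: L2_square_integrable)
  also have "\<dots> = 2 + 2 / (\<alpha> * \<beta>) * Im (l2_inner a b)"
    using pos by (simp add: \<alpha>_def \<beta>_def l2_norm_square[symmetric])
  finally have "\<alpha> * \<beta> * (2 - (l2_norm (\<lambda>x. a x / complex_of_real \<alpha> + \<i> * (b x / complex_of_real \<beta>)))\<^sup>2)
      = - 2 * Im (l2_inner a b)"
    using pos by (simp add: field_simps)
  then show ?thesis by (simp add: \<alpha>_def \<beta>_def)
qed

theorem theorem3p4:
  fixes \<phi> :: "real^'n \<Rightarrow> complex"
  assumes "\<phi> \<in> dom_A \<inter> dom_B"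
    and "\<not> l2_zero (op_A \<phi>)"
    and "\<not> l2_zero (op_B \<phi>)"
  shows "complex_of_real (2 * (grad_norm \<phi>)\<^sup>2) = 2 * l2_inner (op_B \<phi>) \<phi>
    \<and> 2 * l2_inner (op_B \<phi>) \<phi> = - \<i> * commutator_form op_A op_B \<phi> \<phi>
    \<and> - \<i> * commutator_form op_A op_B \<phi> \<phi>
        = complex_of_real (- 2 * Im (l2_inner (op_A \<phi>) (op_B \<phi>)))
    \<and> - 2 * Im (l2_inner (op_A \<phi>) (op_B \<phi>))
        = l2_norm (op_A \<phi>) * l2_norm (op_B \<phi>) *
          (2 - (l2_norm (\<lambda>x. op_A \<phi> x / complex_of_real (l2_norm (op_A \<phi>))
                          + \<i> * (op_B \<phi> x / complex_of_real (l2_norm (op_B \<phi>)))))\<^sup>2)"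
proof -
  have \<phi>: "\<phi> \<in> H1" "\<And>j. weak_partial j \<phi> \<in> H1" and xg: "x_grad \<phi> \<in> L2"
    using assms(1) by (auto simp: dom_A_def dom_B_def H2_def)
  have \<phi>L: "\<phi> \<in> L2" using \<phi>(1) by (simp add: H1_def)
  define g where "g k = weak_partial k \<phi>" for k
  define h where "h j k = weak_partial j (g k)" for j k
  have g: "g k \<in> L2" "is_weak_partial k \<phi> (g k)" for k
    using weak_partial_H1[OF \<phi>(1)] by (simp_all add: g_def)
  have h: "h j k \<in> L2" "is_weak_partial j (g k) (h j k)" for j k
    using weak_partial_H1[OF \<phi>(2)] by (simp_all add: h_def g_def)
  define G where "G = (\<Sum>j\<in>UNIV. sqint (g j))"
  have grad: "(grad_norm \<phi>)\<^sup>2 = G"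
    by (simp add: grad_norm_def G_def g_def l2_norm_square sum_nonneg)
  let ?L = "\<lambda>x. \<Sum>j\<in>UNIV. h j j x"
  have LL: "?L \<in> L2" by (intro L2_sum h) simp
  have B: "op_B \<phi> = (\<lambda>x. - ?L x)" by (simp add: op_B_def h_def g_def fun_eq_iff)
  have BL: "op_B \<phi> \<in> L2" unfolding B using L2_cmult[OF LL, of "- 1"] by simp
  have A: "op_A \<phi> = (\<lambda>x. - \<i> * x_grad \<phi> x + - \<i> * (of_nat CARD('n) / 2) * \<phi> x)"
    by (simp add: op_A_def fun_eq_iff)
  have AL: "op_A \<phi> \<in> L2" unfolding A by (intro L2_add L2_cmult xg \<phi>L)
  have inner_B: "l2_inner (op_B \<phi>) \<phi> = complex_of_real G"
  proof -
    have "(LINT x|lborel. h j j x * cnj (\<phi> x)) = - complex_of_real (sqint (g j))" for j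
    proof -
      have "(LINT x|lborel. h j j x * cnj (\<phi> x)) + (LINT x|lborel. g j x * cnj (g j x)) = 0"
        by (intro weak_partial_by_parts[where j=j] g h \<phi>L L2_cnj is_weak_partial_cnj)
      then show ?thesis
        using l2_inner_self[of "g j"] by (simp add: l2_inner_def eq_neg_iff_add_eq_0)
    qed
    then have "(\<Sum>j\<in>UNIV. LINT x|lborel. h j j x * cnj (\<phi> x)) = - complex_of_real G"
      by (simp add: G_def sum_negf)
    moreover have "l2_inner (op_B \<phi>) \<phi> = - (\<Sum>j\<in>UNIV. LINT x|lborel. h j j x * cnj (\<phi> x))"
      by (simp add: l2_inner_def B sum_distrib_right L2_mult_integrable h \<phi>L L2_cnj)
    ultimately show ?thesis by simp
  qed
  define z where "z = l2_inner (op_A \<phi>) (op_B \<phi>)"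
  have "Re (LINT x|lborel. x_grad \<phi> x * cnj (?L x)) = (real CARD('n) / 2 - 1) * G"
    using virial_identity[OF g h] xg by (simp add: x_grad_def[abs_def] g_def G_def)
  moreover have "(LINT x|lborel. \<phi> x * cnj (?L x)) = - complex_of_real G"
  proof -
    have "l2_inner \<phi> (op_B \<phi>) = complex_of_real G"
      using inner_B by (subst l2_inner_commute) simp
    then show ?thesis by (simp add: l2_inner_def B flip: minus_equation_iff)
  qed
  \<comment> \<open>The minus sign of \<open>op_B\<close> turns the factor -i of \<open>op_A\<close>
    into i, so imaginary parts become real parts of the two integrals.\<close>
  moreover have "z = \<i> * (LINT x|lborel. x_grad \<phi> x * cnj (?L x))
      + \<i> * (of_nat CARD('n) / 2) * (LINT x|lborel. \<phi> x * cnj (?L x))"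
  proof -
    have "z = (LINT x|lborel. \<i> * (x_grad \<phi> x * cnj (?L x)) + \<i> * (of_nat CARD('n) / 2) * (\<phi> x * cnj (?L x)))"
      unfolding z_def l2_inner_def A B by (rule Bochner_Integration.integral_cong) (simp_all add: algebra_simps)
    then show ?thesis
      using L2_mult_integrable[OF xg L2_cnj[OF LL]] L2_mult_integrable[OF \<phi>L L2_cnj[OF LL]] by simp
  qed
  moreover have "Im (\<i> * p + \<i> * (of_nat CARD('n) / 2) * q) = Re p + real CARD('n) / 2 * Re q" for p q
    by simp
  \<comment> \<open>The two contributions of size n G / 2 cancel and leave -G.\<close>
  ultimately have "Im z = (real CARD('n) / 2 - 1) * G + real CARD('n) / 2 * Re (- complex_of_real G)"
    by (simp only:)
  then have Im_z: "Im z = - G"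
    by (simp add: algebra_simps)
  \<comment> \<open>With equal arguments the form is \<open>cnj z - z\<close>, that is -2 i Im
    z.\<close>
  have comm: "- \<i> * commutator_form op_A op_B \<phi> \<phi> = complex_of_real (- 2 * Im z)"
    unfolding commutator_form_def l2_inner_commute[of "op_B \<phi>" "op_A \<phi>"] z_def[symmetric]
    by (simp add: complex_eq_iff)
  show ?thesis
    using l2_norm_normalized_sum[OF AL assms(2) BL assms(3)] comm inner_B Im_z
    unfolding grad z_def[symmetric] by simp
qed

end
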